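(* There exists a constant $\varepsilon>0$ and a function $g:\mathbb{N}\to\mathbb{R}_{\ge 0}$ with $g(m)/m\to 0$ as $m\to\infty$ such that for every bin packing instance $I=(x_1,\dots,x_n)$, $$\mathbb{E}_{\sigma}\big[\mathrm{BF}(I_\sigma)\big]\le \left(\tfrac32-\varepsilon\right)\mathrm{Opt}(I)+g(\mathrm{Opt}(I)),$$ where $\sigma$ is drawn uniformly at random from the set $\mathcal S_n$ of permutations of $[n]$. In particular, the random-order ratio of Best-Fit is at most $3/2-\varepsilon$.
   Context: Bin packing: an instance is a list $I=(x_1,\dots,x_n)$ of items with sizes $s(x_i)\in(0,1]$; the goal is to partition the items into the minimum number of unit-capacity bins (total size in each bin at most $1$); $\mathrm{Opt}(I)$ denotes this minimum. The load of a bin is the total size of its items. Best-Fit (BF) is the online algorithm that processes items one by one in the given order and places each item into the fullest (largest current load) already-opened bin in which it fits, opening a new bin only if it fits in no existing bin; $\mathrm{BF}(J)$ denotes the number of bins it uses on the sequence $J$. For a permutation $\sigma$ of $[n]$, $I_\sigma=(x_{\sigma(1)},\dots,x_{\sigma(n)})$. The random-order ratio of an online algorithm $\mathcal A$ is $RR^\infty_{\mathcal A}=\limsup_{m\to\infty}\sup_{I:\mathrm{Opt}(I)=m}\mathbb{E}_\sigma[\mathcal A(I_\sigma)]/\mathrm{Opt}(I)$, with $\sigma$ uniform over permutations. *)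

theory Defs
  imports "HOL-Probability.Probability" "HOL-Combinatorics.Permutations"
begin

text \<open>An instance is the list of its item sizes; an item is a position in that list, so that
  different items may have equal sizes.\<close>

definition bin_packing_instance :: "real list \<Rightarrow> bool" where
  "bin_packing_instance I \<longleftrightarrow> (\<forall>x\<in>set I. 0 < x \<and> x \<le> 1)"

definition bin_packing :: "real list \<Rightarrow> nat set set \<Rightarrow> bool" where
  "bin_packing I P \<longleftrightarrow> partition_on {..<length I} P \<and> (\<forall>B\<in>P. (\<Sum>i\<in>B. I ! i) \<le> 1)"

definition Opt :: "real list \<Rightarrow> nat" where
  "Opt I = (LEAST k. \<exists>P. bin_packing I P \<and> card P = k)"

definition bin_load :: "real list \<Rightarrow> real" where
  "bin_load b = sum_list b"

definition fitting_bins :: "real list list \<Rightarrow> real \<Rightarrow> nat set" where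
  "fitting_bins bs x = {j. j < length bs \<and> bin_load (bs ! j) + x \<le> 1}"

text \<open>Ties between equally full bins go to the bin opened first. This choice does not affect the
  multiset of loads, hence not the number of bins used.\<close>

definition best_bin :: "real list list \<Rightarrow> real \<Rightarrow> nat" where
  "best_bin bs x = (LEAST j. j \<in> fitting_bins bs x \<and>
     (\<forall>i\<in>fitting_bins bs x. bin_load (bs ! i) \<le> bin_load (bs ! j)))"

definition best_fit_step :: "real list list \<Rightarrow> real \<Rightarrow> real list list" where
  "best_fit_step bs x =
     (if fitting_bins bs x = {} then bs @ [[x]]
      else bs[best_bin bs x := bs ! best_bin bs x @ [x]])"

definition BF :: "real list \<Rightarrow> nat" where
  "BF J = length (foldl best_fit_step [] J)"

definition random_order_expectation :: "(real list \<Rightarrow> nat) \<Rightarrow> real list \<Rightarrow> real" where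
  "random_order_expectation A I =
     measure_pmf.expectation (pmf_of_set {\<sigma>. \<sigma> permutes {..<length I}})
       (\<lambda>\<sigma>. real (A (permute_list \<sigma> I)))"

text \<open>Taken in the extended reals, since for a general algorithm the supremum may be infinite.\<close>

definition random_order_ratio :: "(real list \<Rightarrow> nat) \<Rightarrow> ereal" where
  "random_order_ratio A =
     limsup (\<lambda>m. SUP I\<in>{I. bin_packing_instance I \<and> Opt I = m}.
       ereal (random_order_expectation A I / real (Opt I)))"

end

theory Submission
  imports Defs "HOL-Real_Asymp.Real_Asymp"
begin

text \<open>
  Call an item large if its size exceeds 1/2, medium if it lies in (8/25, 1/2] and small otherwise, and
  give it weight 1, 1/2 and 0 respectively. At most one bin has load at most 1/2 at any time. A step is
  wasteful if it puts a small item into a new bin or into a bin of load at most 1/2; then all other bins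
  have load above 17/25, so up to the last wasteful step at most 25/17 times the volume packed so
  far (and 25/17 < 3/2) is spent on bins. After it, the number of bins grows by at most the weight of the
  arriving items, minus 1/2 for every gainful step, in which a medium item joins a bin of load
  above 1/2 or a large item joins any bin. An optimal bin has weight at most 3/2, and more than 1
  only if it holds a large and a medium item, or three medium ones.

  Prefix volumes and weights of a random permutation concentrate, so the factor 3/2 can only be approached
  if the last wasteful step comes early and almost every optimal bin is of one of these two kinds. In that
  case a positive fraction of the blocks of consecutive non-small items has a shape that forces a
  gainful step whatever the current state is: either medium and large items alternate and each
  medium one fits with each large one, or seven medium items of size at most 1/3 arrive in descending order with
  little small volume between them.
\<close>

section \<open>Best-Fit steps and the potential\<close>

text \<open>The threshold 8/25 has to lie just below 1/3. Being below 1/3, it makes a bin that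
  refuses a small item fuller than 2/3, which brings 25/17 under 3/2. Being above 1/4, it rules out
  four medium items in a bin and makes any two exceed 1/2. Being close to 1/3, it leaves at most
  1/25 of a bin beside three medium items, so a packing made almost wholly of such bins has too
  little small volume to spoil most blocks. Two dependencies shape the probabilistic part. The last
  wasteful step depends on the permutation, so prefix sums must be controlled at all lengths at
  once; a grid of constantly many lengths does this at a cost of order sqrt m. The state in which a
  block starts depends on everything before it; hence a block must force a gain from every state,
  and only the expected number of good blocks is computed, by linearity. Since the big values are
  exchangeable once the positions of the big items and all small items are fixed, the small volume
  of a block and the classes of its big items can be treated separately.\<close>

definition item_weight :: "real \<Rightarrow> real" where
  "item_weight x = (if x > 1/2 then 1 else if x > 8/25 then 1/2 else 0)"

text \<open>This and \<open>gainful\<close> quantify over the fitting bins instead of naming the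
  chosen one: Best-Fit takes the fullest, so some fitting bin is above 1/2 exactly if the chosen one
  is.\<close>

definition wasteful :: "real list list \<Rightarrow> real \<Rightarrow> bool" where
  "wasteful bs x \<longleftrightarrow> x \<le> 8/25 \<and> (\<forall>j\<in>fitting_bins bs x. bin_load (bs ! j) \<le> 1/2)"

definition gainful :: "real list list \<Rightarrow> real \<Rightarrow> bool" where
  "gainful bs x \<longleftrightarrow> x > 8/25 \<and> (\<exists>j\<in>fitting_bins bs x. bin_load (bs ! j) > 1/2 \<or> x > 1/2)"

definition half_full :: "real list list \<Rightarrow> bool" where
  "half_full bs \<longleftrightarrow> (\<forall>j<length bs. 0 < bin_load (bs ! j)) \<and>
     (\<forall>i j. i < length bs \<longrightarrow> j < length bs \<longrightarrow> bin_load (bs ! i) \<le> 1/2 \<longrightarrow>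
        bin_load (bs ! j) \<le> 1/2 \<longrightarrow> i = j)"

text \<open>Kept as a set so that it can be equated with \<open>set_option l\<close>; under
  \<open>half_full\<close> it has at most one element.\<close>

definition low_loads :: "real list list \<Rightarrow> real set" where
  "low_loads bs = {l. l \<le> 1/2 \<and> (\<exists>j<length bs. bin_load (bs ! j) = l)}"

text \<open>The low bin counts for one half only: a medium item, of weight 1/2, may open it, and the
  item that later lifts it above 1/2 pays for the other half.\<close>

definition potential :: "real list list \<Rightarrow> real" where
  "potential bs = real (length bs) - (if low_loads bs = {} then 0 else 1/2)"

lemma bin_load_snoc [simp]: "bin_load (b @ [x]) = bin_load b + x"
  by (simp add: bin_load_def)

lemma bin_load_single [simp]: "bin_load [x] = x"
  by (simp add: bin_load_def)

text \<open>The strict inequality for earlier bins keeps the tie-breaking rule visible;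
  \<open>small_run_shielded\<close> depends on it.\<close>

lemma best_fit_step_cases:
  obtains (new) "fitting_bins bs x = {}" "best_fit_step bs x = bs @ [[x]]"
  | (old) j where "j \<in> fitting_bins bs x" "best_fit_step bs x = bs[j := bs ! j @ [x]]"
      "\<And>i. i \<in> fitting_bins bs x \<Longrightarrow> bin_load (bs ! i) \<le> bin_load (bs ! j)"
      "\<And>i. i \<in> fitting_bins bs x \<Longrightarrow> i < j \<Longrightarrow> bin_load (bs ! i) < bin_load (bs ! j)"
proof (cases "fitting_bins bs x = {}")
  case True
  then show ?thesis using new by (simp add: best_fit_step_def)
next
  case False
  let ?Q = "\<lambda>j. j \<in> fitting_bins bs x \<and>
     (\<forall>i\<in>fitting_bins bs x. bin_load (bs ! i) \<le> bin_load (bs ! j))"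
  have fin: "finite (fitting_bins bs x)" by (simp add: fitting_bins_def)
  have "Max ((\<lambda>i. bin_load (bs ! i)) ` fitting_bins bs x) \<in> (\<lambda>i. bin_load (bs ! i)) ` fitting_bins bs x"
    using fin False by (intro Max_in) auto
  then obtain j0 where "j0 \<in> fitting_bins bs x"
    "Max ((\<lambda>i. bin_load (bs ! i)) ` fitting_bins bs x) = bin_load (bs ! j0)" by auto
  then have "?Q j0" using fin by (metis Max_ge finite_imageI imageI)
  then have Q: "?Q (best_bin bs x)" unfolding best_bin_def by (rule LeastI)
  show ?thesis
  proof (rule old[of "best_bin bs x"])
    show "best_fit_step bs x = bs[best_bin bs x := bs ! best_bin bs x @ [x]]"
      using False by (simp add: best_fit_step_def)
    fix i assume i: "i \<in> fitting_bins bs x" "i < best_bin bs x"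
    then have "\<not> ?Q i" using not_less_Least[OF i(2)[unfolded best_bin_def]] by blast
    with i Q show "bin_load (bs ! i) < bin_load (bs ! best_bin bs x)"
      by (meson dual_order.trans not_le_imp_less)
  qed (use Q in auto)
qed

lemma fitting_binsI: "j < length bs \<Longrightarrow> bin_load (bs ! j) + x \<le> 1 \<Longrightarrow> j \<in> fitting_bins bs x"
  by (simp add: fitting_bins_def)

lemma fitting_binsD: "j \<in> fitting_bins bs x \<Longrightarrow> j < length bs \<and> bin_load (bs ! j) + x \<le> 1"
  by (simp add: fitting_bins_def)

lemma half_full_unique:
  "half_full bs \<Longrightarrow> i < length bs \<Longrightarrow> j < length bs \<Longrightarrow> bin_load (bs ! i) \<le> 1/2 \<Longrightarrow>
    bin_load (bs ! j) \<le> 1/2 \<Longrightarrow> i = j"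
  unfolding half_full_def by blast

lemma half_full_pos: "half_full bs \<Longrightarrow> j < length bs \<Longrightarrow> 0 < bin_load (bs ! j)"
  unfolding half_full_def by blast

lemma half_fullI:
  assumes "\<And>j. j < length bs \<Longrightarrow> 0 < bin_load (bs ! j)"
    and "\<And>i j. i < j \<Longrightarrow> j < length bs \<Longrightarrow> bin_load (bs ! i) > 1/2 \<or> bin_load (bs ! j) > 1/2"
  shows "half_full bs"
  unfolding half_full_def using assms by (meson linorder_neqE_nat not_le)

text \<open>An item that opens a bin fits into none, so beside a bin of load at most 1/2 it must
  itself exceed 1/2. Existing loads never decrease.\<close>

lemma half_full_step:
  assumes "half_full bs" "x > 0"
  shows "half_full (best_fit_step bs x)"
proof (cases rule: best_fit_step_cases[of bs x])
  case new
  have *: "bin_load (bs ! j) > 1/2 \<or> x > 1/2" if "j < length bs" for j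
    using new(1) fitting_binsI[OF that, of x] by fastforce
  have "half_full (bs @ [[x]])"
  proof (rule half_fullI)
    fix i j assume ij: "i < j" "j < length (bs @ [[x]])"
    show "bin_load ((bs @ [[x]]) ! i) > 1/2 \<or> bin_load ((bs @ [[x]]) ! j) > 1/2"
    proof (cases "j = length bs")
      case True
      then show ?thesis using * ij by (simp add: nth_append)
    next
      case False
      then show ?thesis using ij half_full_unique[OF assms(1), of i j] by (fastforce simp: nth_append)
    qed
  qed (use half_full_pos[OF assms(1)] assms(2) in \<open>auto simp: nth_append less_Suc_eq\<close>)
  then show ?thesis using new(2) by simp
next
  case (old j)
  then have j: "j < length bs" by (simp add: fitting_bins_def)
  have *: "bin_load (bs[j := bs ! j @ [x]] ! i) \<ge> bin_load (bs ! i)" if "i < length bs" for i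
    using that j assms(2) by (simp add: nth_list_update)
  have "half_full (bs[j := bs ! j @ [x]])"
  proof (rule half_fullI)
    show "0 < bin_load (bs[j := bs ! j @ [x]] ! i)" if "i < length (bs[j := bs ! j @ [x]])" for i
      using *[of i] half_full_pos[OF assms(1), of i] that by simp
    show "bin_load (bs[j := bs ! j @ [x]] ! i) > 1/2 \<or> bin_load (bs[j := bs ! j @ [x]] ! k) > 1/2"
      if "i < k" "k < length (bs[j := bs ! j @ [x]])" for i k
      using *[of i] *[of k] half_full_unique[OF assms(1), of i k] that by fastforce
  qed
  then show ?thesis using old(2) by simp
qed

lemma low_loads_eq: "low_loads bs = bin_load ` set bs \<inter> {..1/2}"
  by (force simp: low_loads_def in_set_conv_nth)

lemma low_loads_append [simp]:
  "low_loads (bs @ [b]) = low_loads bs \<union> (if bin_load b \<le> 1/2 then {bin_load b} else {})"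
  by (auto simp: low_loads_eq)

lemma small_step:
  assumes "x > 0" "x \<le> 8/25" "\<not> wasteful bs x"
  obtains j where "j < length bs" "bin_load (bs ! j) > 1/2" "bin_load (bs ! j) + x \<le> 1"
    "best_fit_step bs x = bs[j := bs ! j @ [x]]"
    "\<forall>i<j. bin_load (bs ! i) + x \<le> 1 \<longrightarrow> bin_load (bs ! i) < bin_load (bs ! j)"
proof -
  obtain i where i: "i \<in> fitting_bins bs x" "bin_load (bs ! i) > 1/2"
    using assms unfolding wasteful_def by force
  show ?thesis
  proof (cases rule: best_fit_step_cases[of bs x])
    case new with i show ?thesis by simp
  next
    case (old j)
    show ?thesis
    proof (rule that[of j])
      show "bin_load (bs ! j) > 1/2" using old(3)[OF i(1)] i(2) by simp
      show "\<forall>i<j. bin_load (bs ! i) + x \<le> 1 \<longrightarrow> bin_load (bs ! i) < bin_load (bs ! j)"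
        using old(4) fitting_binsD[OF old(1)] by (simp add: fitting_bins_def)
    qed (use old fitting_binsD[OF old(1)] in \<open>auto simp: fitting_bins_def\<close>)
  qed
qed

lemma low_loads_update:
  assumes "j < length bs" "bin_load (bs ! j) > 1/2" "bin_load b > 1/2"
  shows "low_loads (bs[j := b]) = low_loads bs"
proof -
  have "(\<exists>i<length bs. bin_load (bs[j := b] ! i) = l) \<longleftrightarrow> (\<exists>i<length bs. bin_load (bs ! i) = l)"
    if "l \<le> 1/2" for l
    using assms that by (intro ex_cong) (auto simp: nth_list_update)
  then show ?thesis by (auto simp: low_loads_def)
qed

lemma low_loads_small_step:
  assumes "x > 0" "x \<le> 8/25" "\<not> wasteful bs x"
  shows "low_loads (best_fit_step bs x) = low_loads bs"
    and "length (best_fit_step bs x) = length bs"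
proof -
  obtain j where j: "j < length bs" "bin_load (bs ! j) > 1/2" and "bin_load (bs ! j) + x \<le> 1"
      and step: "best_fit_step bs x = bs[j := bs ! j @ [x]]"
    by (rule small_step[OF assms])
  have "bin_load (bs ! j @ [x]) > 1/2" using j(2) assms(1) by simp
  from low_loads_update[OF j this]
  have "low_loads (best_fit_step bs x) = low_loads bs \<and> length (best_fit_step bs x) = length bs"
    by (simp add: step)
  then show "low_loads (best_fit_step bs x) = low_loads bs" "length (best_fit_step bs x) = length bs"
    by auto
qed

lemma low_loads_unique:
  assumes "half_full bs" "j < length bs" "bin_load (bs ! j) \<le> 1/2"
  shows "low_loads bs = {bin_load (bs ! j)}"
proof
  show "low_loads bs \<subseteq> {bin_load (bs ! j)}"
  proof
    fix l assume "l \<in> low_loads bs"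
    then obtain i where "i < length bs" "bin_load (bs ! i) \<le> 1/2" "l = bin_load (bs ! i)"
      unfolding low_loads_def by blast
    then show "l \<in> {bin_load (bs ! j)}" using half_full_unique[OF assms(1), of i j] assms(2,3) by blast
  qed
  show "{bin_load (bs ! j)} \<subseteq> low_loads bs" using assms(2,3) unfolding low_loads_def by blast
qed

lemma low_loads_fill:
  assumes "half_full bs" "j < length bs" "bin_load (bs ! j) \<le> 1/2" "x > 0"
  shows "low_loads (bs[j := bs ! j @ [x]]) =
    (if bin_load (bs ! j) + x \<le> 1/2 then {bin_load (bs ! j) + x} else {})"
proof -
  let ?bs = "bs[j := bs ! j @ [x]]"
  have j: "bin_load (?bs ! j) = bin_load (bs ! j) + x" "j < length ?bs" using assms(2) by simp_all
  have 1: "l \<le> 1/2 \<and> l = bin_load (bs ! j) + x" if "l \<in> low_loads ?bs" for l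
  proof -
    from that obtain i where i: "i < length bs" "bin_load (?bs ! i) \<le> 1/2" "l = bin_load (?bs ! i)"
      unfolding low_loads_def length_list_update by blast
    have "i = j"
    proof (rule ccontr)
      assume "i \<noteq> j"
      then have "bin_load (bs ! i) \<le> 1/2" using i(2) by simp
      then show False using half_full_unique[OF assms(1) i(1) assms(2) _ assms(3)] \<open>i \<noteq> j\<close> by blast
    qed
    show ?thesis using i(2,3) unfolding \<open>i = j\<close> j(1) by (simp only: conj_absorb simp_thms)
  qed
  have 2: "bin_load (bs ! j) + x \<in> low_loads ?bs" if "bin_load (bs ! j) + x \<le> 1/2"
    using j that unfolding low_loads_def by blast
  show ?thesis
  proof (cases "bin_load (bs ! j) + x \<le> 1/2")
    case True
    have "low_loads ?bs = {bin_load (bs ! j) + x}" using 1 2[OF True] by blast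
    with True show ?thesis by (simp only: if_True)
  next
    case False
    have "low_loads ?bs = {}" using 1 False by blast
    with False show ?thesis by (simp only: if_False)
  qed
qed

lemma large_step_new:
  assumes "x > 1/2" "\<not> gainful bs x"
  shows "best_fit_step bs x = bs @ [[x]]" "l \<in> low_loads bs \<Longrightarrow> l + x > 1"
proof -
  have e: "fitting_bins bs x = {}" using assms by (auto simp: gainful_def)
  then show "best_fit_step bs x = bs @ [[x]]" by (simp add: best_fit_step_def)
  show "l \<in> low_loads bs \<Longrightarrow> l + x > 1"
    using e by (force simp: low_loads_def fitting_bins_def)
qed

lemma medium_step_new:
  assumes "x > 8/25" "\<not> gainful bs x" "low_loads bs = {}"
  shows "fitting_bins bs x = {}" "best_fit_step bs x = bs @ [[x]]"
proof -
  have "bin_load (bs ! j) > 1/2" if "j < length bs" for j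
    using assms(3) that unfolding low_loads_def by force
  then show "fitting_bins bs x = {}"
    using assms(1,2) unfolding gainful_def fitting_bins_def by blast
  then show "best_fit_step bs x = bs @ [[x]]" by (simp add: best_fit_step_def)
qed

text \<open>A bin of load at most 1/2 always accepts a medium item, and without a gain no bin above
  1/2 does, so the choice is forced.\<close>

lemma medium_step_join:
  assumes "half_full bs" "x > 8/25" "x \<le> 1/2" "\<not> gainful bs x" "j < length bs" "bin_load (bs ! j) \<le> 1/2"
  shows "best_fit_step bs x = bs[j := bs ! j @ [x]]"
proof (cases rule: best_fit_step_cases[of bs x])
  case new
  then show ?thesis using assms(3,5,6) fitting_binsI[of j bs x] by auto
next
  case (old i)
  have "bin_load (bs ! i) \<le> 1/2" using old(1) assms(2,4) unfolding gainful_def by force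
  then have "i = j" using assms(1,5,6) fitting_binsD[OF old(1)] unfolding half_full_def by blast
  then show ?thesis using old(2) by simp
qed

text \<open>A small item changes nothing, a large item in a new bin pays 1, a medium item that opens
  or fills the low bin pays at most 1/2. In a gainful step no bin is opened: a medium item then
  costs nothing, and a large item only ends the discount of 1/2 for the low bin.\<close>

lemma potential_step:
  assumes inv: "half_full bs" and x: "x > 0" and nw: "\<not> wasteful bs x"
  shows "potential (best_fit_step bs x) \<le>
    potential bs + item_weight x - (if gainful bs x then 1/2 else 0)"
proof -
  consider "x \<le> 8/25" | "x > 1/2" "gainful bs x" | "x > 1/2" "\<not> gainful bs x"
    | "x > 8/25" "x \<le> 1/2" "gainful bs x"
    | "x > 8/25" "x \<le> 1/2" "\<not> gainful bs x" "low_loads bs = {}"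
    | "x > 8/25" "x \<le> 1/2" "\<not> gainful bs x" "low_loads bs \<noteq> {}" by linarith
  then show ?thesis
  proof cases
    case 1
    then show ?thesis using low_loads_small_step[OF x 1 nw]
      by (simp add: potential_def item_weight_def gainful_def)
  next
    case 2
    then have ne: "fitting_bins bs x \<noteq> {}" by (auto simp: gainful_def)
    show ?thesis
    proof (cases rule: best_fit_step_cases[of bs x])
      case new with ne show ?thesis by simp
    next
      case (old j)
      have j: "j < length bs" "bin_load (bs ! j) \<le> 1/2" using fitting_binsD[OF old(1)] 2(1) by auto
      have "bin_load (bs ! j) > 0" using inv j(1) unfolding half_full_def by blast
      then have "low_loads (best_fit_step bs x) = {}" "low_loads bs \<noteq> {}"
        using low_loads_fill[OF inv j x] low_loads_unique[OF inv j] old(2) 2 by auto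
      then show ?thesis using old(2) 2 by (simp add: potential_def item_weight_def)
    qed
  next
    case 3
    then show ?thesis using large_step_new[of x bs] by (simp add: potential_def item_weight_def)
  next
    case 4
    then obtain i where i: "i \<in> fitting_bins bs x" "bin_load (bs ! i) > 1/2" by (auto simp: gainful_def)
    show ?thesis
    proof (cases rule: best_fit_step_cases[of bs x])
      case new with i show ?thesis by simp
    next
      case (old j)
      have j: "j < length bs" "bin_load (bs ! j) > 1/2" using fitting_binsD[OF old(1)] old(3)[OF i(1)] i(2) by auto
      then have "low_loads (best_fit_step bs x) = low_loads bs"
        using low_loads_update[OF j] old(2) x by simp
      then show ?thesis using old(2) 4 by (simp add: potential_def item_weight_def)
    qed
  next
    case 5
    then show ?thesis using medium_step_new[of x bs] by (simp add: potential_def item_weight_def)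
  next
    case 6
    then obtain j where j: "j < length bs" "bin_load (bs ! j) \<le> 1/2" by (auto simp: low_loads_def)
    then show ?thesis using 6 medium_step_join[OF inv 6(1-3) j]
      by (simp add: potential_def item_weight_def)
  qed
qed

lemma half_full_run:
  "half_full bs \<Longrightarrow> \<forall>x\<in>set J. 0 < x \<Longrightarrow> half_full (foldl best_fit_step bs J)"
  by (induction J arbitrary: bs) (auto simp: half_full_step)

lemma half_full_Nil [simp]: "half_full []"
  by (simp add: half_full_def)

definition total_load :: "real list list \<Rightarrow> real" where
  "total_load bs = (\<Sum>j<length bs. bin_load (bs ! j))"

lemma total_load_step: "total_load (best_fit_step bs x) = total_load bs + x"
proof (cases rule: best_fit_step_cases[of bs x])
  case new
  then show ?thesis by (simp add: total_load_def nth_append)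
next
  case (old j)
  then have j: "j < length bs" by (simp add: fitting_bins_def)
  have "bin_load (bs[j := bs ! j @ [x]] ! i) = bin_load (bs ! i) + (if i = j then x else 0)"
    if "i < length bs" for i using that j by (simp add: nth_list_update)
  then have "total_load (best_fit_step bs x) = (\<Sum>i<length bs. bin_load (bs ! i) + (if i = j then x else 0))"
    using old(2) by (simp add: total_load_def)
  also have "\<dots> = total_load bs + x" using j by (simp add: sum.distrib total_load_def sum.delta)
  finally show ?thesis .
qed

lemma length_step_le: "length (best_fit_step bs x) \<le> Suc (length bs)"
  by (simp add: best_fit_step_def)

text \<open>Every bin above 1/2 refuses an item of size at most 8/25, so its load exceeds 17/25. The
  summand 1 is for the single bin that may be at most half full.\<close>

lemma length_at_waste:
  assumes inv: "half_full bs" and w: "wasteful bs x"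
  shows "real (length bs) \<le> 1 + 25/17 * total_load bs"
proof -
  have pos: "0 < bin_load (bs ! j)" if "j < length bs" for j using inv that unfolding half_full_def by blast
  have full: "bin_load (bs ! j) > 17/25" if "j < length bs" "bin_load (bs ! j) > 1/2" for j
    using that w fitting_binsI[of j bs x] unfolding wasteful_def by force
  let ?A = "{j\<in>{..<length bs}. bin_load (bs ! j) \<le> 1/2}"
  have "card ?A \<le> 1"
    using inv unfolding half_full_def One_nat_def by (subst card_le_Suc0_iff_eq) auto
  moreover have "card {..<length bs} \<le> card ?A + card ({..<length bs} - ?A)"
    by (rule order_trans[OF card_mono card_Un_le]) auto
  ultimately have c: "real (length bs) \<le> 1 + real (card ({..<length bs} - ?A))" by simp
  have "17/25 * real (card ({..<length bs} - ?A)) \<le> (\<Sum>j\<in>{..<length bs} - ?A. bin_load (bs ! j))"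
    using full by (subst mult.commute, intro sum_bounded_below) (auto intro: less_imp_le)
  also have "\<dots> \<le> total_load bs" unfolding total_load_def
    using pos by (intro sum_mono2) (auto intro: less_imp_le)
  finally show ?thesis using c by simp
qed

section \<open>Accounting along a whole run\<close>

definition state_at :: "real list \<Rightarrow> nat \<Rightarrow> real list list" where
  "state_at J p = foldl best_fit_step [] (take p J)"

lemma state_at_Suc: "p < length J \<Longrightarrow> state_at J (Suc p) = best_fit_step (state_at J p) (J ! p)"
  by (simp add: state_at_def take_Suc_conv_app_nth)

lemma state_at_half_full: "\<forall>x\<in>set J. 0 < x \<Longrightarrow> half_full (state_at J p)"
  unfolding state_at_def by (rule half_full_run) (auto dest: in_set_takeD)

lemma total_load_state_at: "p \<le> length J \<Longrightarrow> total_load (state_at J p) = (\<Sum>i<p. J ! i)"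
proof (induction p)
  case 0
  then show ?case by (simp add: state_at_def total_load_def)
next
  case (Suc p)
  then show ?case by (simp add: state_at_Suc total_load_step)
qed

lemma potential_run:
  assumes pos: "\<forall>x\<in>set J. 0 < x" and "t \<le> n" "n \<le> length J"
    and "\<forall>p\<in>{t..<n}. \<not> wasteful (state_at J p) (J ! p)"
  shows "potential (state_at J n) \<le> potential (state_at J t) + (\<Sum>p=t..<n. item_weight (J ! p))
    - real (card {p\<in>{t..<n}. gainful (state_at J p) (J ! p)}) / 2"
  using assms(2-)
proof (induction n rule: dec_induct)
  case base
  then show ?case by simp
next
  case (step n)
  let ?G = "\<lambda>n. {p\<in>{t..<n}. gainful (state_at J p) (J ! p)}"
  have "?G (Suc n) = (if gainful (state_at J n) (J ! n) then insert n (?G n) else ?G n)"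
    using step(1) by (auto simp: less_Suc_eq)
  then have c: "real (card (?G (Suc n))) = real (card (?G n)) + (if gainful (state_at J n) (J ! n) then 1 else 0)"
    by auto
  have "potential (state_at J (Suc n)) \<le> potential (state_at J n) + item_weight (J ! n)
     - (if gainful (state_at J n) (J ! n) then 1/2 else 0)"
    using step pos by (simp add: state_at_Suc potential_step state_at_half_full)
  moreover have "potential (state_at J n) \<le> potential (state_at J t) + (\<Sum>p=t..<n. item_weight (J ! p))
    - real (card (?G n)) / 2" using step by simp
  ultimately show ?case using c step(1) by (simp add: field_simps split: if_splits)
qed

text \<open>The cut t lies just after the last wasteful step, or at 0 if there is none: volume pays
  for the bins before it, the potential for those after it.\<close>

lemma BF_bound:
  assumes pos: "\<forall>x\<in>set J. 0 < x"
  obtains t where "t \<le> length J" "\<forall>p\<in>{t..<length J}. \<not> wasteful (state_at J p) (J ! p)"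
    "real (BF J) \<le> 5/2 + 25/17 * (\<Sum>i<t. J ! i) + (\<Sum>p=t..<length J. item_weight (J ! p))
       - real (card {p\<in>{t..<length J}. gainful (state_at J p) (J ! p)}) / 2"
proof -
  let ?W = "{p. p < length J \<and> wasteful (state_at J p) (J ! p)}"
  have fin: "finite ?W" by simp
  \<comment> \<open>Passing from the potential back to the number of bins costs the discount 1/2;
    together with the 2 obtained next this makes 5/2.\<close>
  have BF: "real (BF J) \<le> potential (state_at J (length J)) + 1/2"
    by (simp add: BF_def state_at_def potential_def)
  \<comment> \<open>The 2 consists of the 1 from \<open>length_at_waste\<close> and one bin that the
    wasteful item itself may open.\<close>
  have "\<exists>t\<le>length J. (\<forall>p\<in>{t..<length J}. \<not> wasteful (state_at J p) (J ! p)) \<and>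
    real (length (state_at J t)) \<le> 2 + 25/17 * (\<Sum>i<t. J ! i)"
  proof (cases "?W = {}")
    case True
    then show ?thesis by (intro exI[of _ 0]) (auto simp: state_at_def)
  next
    case False
    define q where "q = Max ?W"
    have q: "q < length J" "wasteful (state_at J q) (J ! q)" using Max_in[OF fin False] by (auto simp: q_def)
    have after: "\<not> wasteful (state_at J p) (J ! p)" if "p \<in> {Suc q..<length J}" for p
    proof
      assume "wasteful (state_at J p) (J ! p)"
      then have "p \<le> q" unfolding q_def using that fin by (intro Max_ge) auto
      with that show False by simp
    qed
    have "real (length (state_at J (Suc q))) \<le> 1 + real (length (state_at J q))"
      using length_step_le[of "state_at J q" "J ! q"] q by (simp add: state_at_Suc)
    also have "\<dots> \<le> 2 + 25/17 * (\<Sum>i<q. J ! i)"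
      using length_at_waste[OF state_at_half_full[OF pos] q(2)] q(1) by (simp add: total_load_state_at)
    also have "\<dots> \<le> 2 + 25/17 * (\<Sum>i<Suc q. J ! i)" using pos nth_mem[OF q(1)] by (simp add: less_imp_le)
    finally show ?thesis using q after by (intro exI[of _ "Suc q"]) auto
  qed
  then obtain t where t: "t \<le> length J" "\<forall>p\<in>{t..<length J}. \<not> wasteful (state_at J p) (J ! p)"
    "real (length (state_at J t)) \<le> 2 + 25/17 * (\<Sum>i<t. J ! i)" by blast
  have "potential (state_at J t) \<le> real (length (state_at J t))" by (simp add: potential_def)
  then show ?thesis using that[OF t(1,2)] potential_run[OF pos t(1) order_refl t(2)] BF t(3) by linarith
qed

section \<open>Blocks of items that force a gain\<close>

fun calm :: "real list list \<Rightarrow> real list \<Rightarrow> bool" where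
  "calm bs [] \<longleftrightarrow> True"
| "calm bs (x # xs) \<longleftrightarrow> \<not> wasteful bs x \<and> \<not> gainful bs x \<and> calm (best_fit_step bs x) xs"

lemma calm_append: "calm bs (xs @ ys) \<longleftrightarrow> calm bs xs \<and> calm (foldl best_fit_step bs xs) ys"
  by (induction xs arbitrary: bs) auto

text \<open>A calm run treats the bin of load at most 1/2, if there is one, as an automaton driven by
  the items larger than 8/25 alone: smaller items never touch it.\<close>

fun calm_bigs :: "real option \<Rightarrow> real list \<Rightarrow> bool" where
  "calm_bigs l [] \<longleftrightarrow> True"
| "calm_bigs None (x # xs) \<longleftrightarrow> (if x > 1/2 then calm_bigs None xs else calm_bigs (Some x) xs)"
| "calm_bigs (Some l) (x # xs) \<longleftrightarrow>
     (if x > 1/2 then l + x > 1 \<and> calm_bigs (Some l) xs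
      else calm_bigs (if l + x \<le> 1/2 then Some (l + x) else None) xs)"

lemma low_loads_cases:
  assumes "half_full bs"
  obtains "low_loads bs = {}"
  | j where "j < length bs" "bin_load (bs ! j) \<le> 1/2" "low_loads bs = {bin_load (bs ! j)}"
proof (cases "low_loads bs = {}")
  case False
  then obtain j where "j < length bs" "bin_load (bs ! j) \<le> 1/2" unfolding low_loads_def by blast
  with low_loads_unique[OF assms this] that(2) show ?thesis by blast
qed (use that in blast)

lemma low_loads_medium_step:
  assumes "half_full bs" "x > 8/25" "x \<le> 1/2" "\<not> gainful bs x" "low_loads bs = set_option l"
  shows "low_loads (best_fit_step bs x) = set_option
    (case l of None \<Rightarrow> Some x | Some l \<Rightarrow> if l + x \<le> 1/2 then Some (l + x) else None)"
proof (cases l)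
  case None
  then show ?thesis using medium_step_new[OF assms(2,4)] assms(3,5) by simp
next
  case (Some l')
  then have "low_loads bs \<noteq> {}" using assms(5) by simp
  with low_loads_cases[OF assms(1)] obtain j where
    j: "j < length bs" "bin_load (bs ! j) \<le> 1/2" "low_loads bs = {bin_load (bs ! j)}" by blast
  have "l' = bin_load (bs ! j)" using j(3) assms(5) Some by simp
  moreover have "x > 0" using assms(2) by simp
  ultimately show ?thesis
    using low_loads_fill[OF assms(1) j(1,2)] medium_step_join[OF assms(1-4) j(1,2)] Some by simp
qed

lemma calm_imp_calm_bigs:
  "half_full bs \<Longrightarrow> \<forall>x\<in>set w. 0 < x \<Longrightarrow> calm bs w \<Longrightarrow> low_loads bs = set_option l \<Longrightarrow>
    calm_bigs l (filter (\<lambda>x. x > 8/25) w)"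
proof (induction w arbitrary: bs l)
  case Nil
  then show ?case by simp
next
  case (Cons x w)
  have x: "x > 0" "\<not> wasteful bs x" "\<not> gainful bs x" using Cons.prems by auto
  have IH: "calm_bigs l' (filter (\<lambda>x. x > 8/25) w)"
    if "low_loads (best_fit_step bs x) = set_option l'" for l'
    using Cons.IH[OF half_full_step[OF Cons.prems(1) x(1)]] Cons.prems that by simp
  consider "x \<le> 8/25" | "x > 1/2" | "x > 8/25" "x \<le> 1/2" by linarith
  then show ?case
  proof cases
    case 1
    then show ?thesis using IH[of l] low_loads_small_step[OF x(1) 1 x(2)] Cons.prems(4) by simp
  next
    case 2
    have "low_loads (best_fit_step bs x) = set_option l"
      using large_step_new(1)[OF 2 x(3)] Cons.prems(4) 2 by simp
    then have "calm_bigs l (filter (\<lambda>x. x > 8/25) w)" by (rule IH)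
    moreover have "l' + x > 1" if "l = Some l'" for l'
      using large_step_new(2)[OF 2 x(3), of l'] Cons.prems(4) that by simp
    ultimately show ?thesis using 2 by (cases l) simp_all
  next
    case 3
    show ?thesis using IH[OF low_loads_medium_step[OF Cons.prems(1) 3 x(3) Cons.prems(4)]] 3
      by (cases l) simp_all
  qed
qed

lemma set_option_low_loads:
  assumes "half_full bs"
  obtains "low_loads bs = set_option None"
  | l where "low_loads bs = set_option (Some l)" "l > 0"
  by (rule low_loads_cases[OF assms]) (use half_full_pos[OF assms] in auto)

text \<open>Once the low bin holds a single medium item of the block, the next large item fits on
  top of it. With no low bin at the start this happens at l1. A low bin of unknown load is lifted
  above 1/2 by m1, or by m1 and m2 since two medium items exceed 1/2, and then the next pair forces
  the gain; hence three pairs.\<close>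

lemma alternating_block_not_calm:
  assumes "half_full bs" "\<forall>x\<in>set w. 0 < x"
    and "filter (\<lambda>x. x > 8/25) w = [m1, l1, m2, l2, m3, l3]"
    and "\<forall>m\<in>{m1, m2, m3}. m \<le> 1/2" "\<forall>l\<in>{l1, l2, l3}. l > 1/2 \<and> (\<forall>m\<in>{m1, m2, m3}. m + l \<le> 1)"
  shows "\<not> calm bs w"
proof
  assume c: "calm bs w"
  have big: "m1 > 8/25" "m2 > 8/25"
    using arg_cong[OF assms(3), of set] by auto
  show False
  proof (cases rule: set_option_low_loads[OF assms(1)])
    case 1
    have "calm_bigs None [m1, l1, m2, l2, m3, l3]"
      using calm_imp_calm_bigs[OF assms(1,2) c 1] assms(3) by metis
    then show False using assms(4,5) by (simp split: if_splits)
  next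
    case (2 l)
    have "calm_bigs (Some l) [m1, l1, m2, l2, m3, l3]"
      using calm_imp_calm_bigs[OF assms(1,2) c 2(1)] assms(3) by metis
    then show False using assms(4,5) big 2(2) by (simp split: if_splits)
  qed
qed

text \<open>In a calm run each small item joins a bin of load above 1/2. Hence no bin opens, the low
  bin is frozen, and the small volume bounds every increase.\<close>

lemma small_run:
  assumes "calm bs s" "\<forall>x\<in>set s. 0 < x \<and> x \<le> 8/25"
  shows "length (foldl best_fit_step bs s) = length bs"
    and "low_loads (foldl best_fit_step bs s) = low_loads bs"
    and "i < length bs \<Longrightarrow> bin_load (bs ! i) \<le> bin_load (foldl best_fit_step bs s ! i)"
    and "i < length bs \<Longrightarrow> bin_load (foldl best_fit_step bs s ! i) \<le> bin_load (bs ! i) + sum_list s"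
    and "i < length bs \<Longrightarrow> bin_load (bs ! i) \<le> 1/2 \<Longrightarrow>
      bin_load (foldl best_fit_step bs s ! i) = bin_load (bs ! i)"
proof -
  have "length (foldl best_fit_step bs s) = length bs \<and>
    low_loads (foldl best_fit_step bs s) = low_loads bs \<and>
    (\<forall>i<length bs. bin_load (bs ! i) \<le> bin_load (foldl best_fit_step bs s ! i) \<and>
      bin_load (foldl best_fit_step bs s ! i) \<le> bin_load (bs ! i) + sum_list s \<and>
      (bin_load (bs ! i) \<le> 1/2 \<longrightarrow> bin_load (foldl best_fit_step bs s ! i) = bin_load (bs ! i)))"
    using assms
  proof (induction s arbitrary: bs)
    case Nil
    then show ?case by simp
  next
    case (Cons x s)
    have x: "x > 0" "x \<le> 8/25" "\<not> wasteful bs x" using Cons.prems by auto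
    obtain j where j: "j < length bs" "bin_load (bs ! j) > 1/2" and "bin_load (bs ! j) + x \<le> 1"
      and step: "best_fit_step bs x = bs[j := bs ! j @ [x]]"
      by (rule small_step[OF x])
    have ld: "bin_load (best_fit_step bs x ! i) = bin_load (bs ! i) + (if i = j then x else 0)"
      if "i < length bs" for i using that by (simp add: step nth_list_update)
    let ?r = "foldl best_fit_step (best_fit_step bs x) s"
    have IH: "length ?r = length bs \<and> low_loads ?r = low_loads bs \<and>
      (\<forall>i<length bs. bin_load (best_fit_step bs x ! i) \<le> bin_load (?r ! i) \<and>
      bin_load (?r ! i) \<le> bin_load (best_fit_step bs x ! i) + sum_list s \<and>
      (bin_load (best_fit_step bs x ! i) \<le> 1/2 \<longrightarrow> bin_load (?r ! i) = bin_load (best_fit_step bs x ! i)))"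
      using Cons.IH[of "best_fit_step bs x"] Cons.prems low_loads_small_step[OF x] by simp
    have "bin_load (bs ! i) \<le> bin_load (?r ! i) \<and> bin_load (?r ! i) \<le> bin_load (bs ! i) + (x + sum_list s) \<and>
      (bin_load (bs ! i) \<le> 1/2 \<longrightarrow> bin_load (?r ! i) = bin_load (bs ! i))" if i: "i < length bs" for i
    proof (cases "i = j")
      case True
      then show ?thesis using IH[THEN conjunct2, THEN conjunct2, rule_format, OF i] ld[OF i] x(1) j(2) by auto
    next
      case False
      then show ?thesis using IH[THEN conjunct2, THEN conjunct2, rule_format, OF i] ld[OF i] x(1) by auto
    qed
    then show ?case using IH by simp
  qed
  then show "length (foldl best_fit_step bs s) = length bs"
    "low_loads (foldl best_fit_step bs s) = low_loads bs"
    "i < length bs \<Longrightarrow> bin_load (bs ! i) \<le> bin_load (foldl best_fit_step bs s ! i)"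
    "i < length bs \<Longrightarrow> bin_load (foldl best_fit_step bs s ! i) \<le> bin_load (bs ! i) + sum_list s"
    "i < length bs \<Longrightarrow> bin_load (bs ! i) \<le> 1/2 \<Longrightarrow>
      bin_load (foldl best_fit_step bs s ! i) = bin_load (bs ! i)" by simp_all
qed

text \<open>Best-Fit prefers the fuller bin a, and on ties the one opened first.\<close>

lemma small_run_shielded:
  assumes "calm bs s" "\<forall>x\<in>set s. 0 < x \<and> x \<le> 8/25" "a < c" "c < length bs"
    "bin_load (bs ! c) \<le> bin_load (bs ! a)" "bin_load (bs ! a) + sum_list s \<le> 1"
  shows "bin_load (foldl best_fit_step bs s ! c) = bin_load (bs ! c)"
  using assms
proof (induction s arbitrary: bs)
  case Nil
  then show ?case by simp
next
  case (Cons x s)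
  have x: "x > 0" "x \<le> 8/25" "\<not> wasteful bs x" using Cons.prems by auto
  have "sum_list s \<ge> 0" using Cons.prems(2) by (intro sum_list_nonneg) (auto intro: less_imp_le)
  then have fit: "bin_load (bs ! a) + x \<le> 1" using Cons.prems(6) by simp
  obtain j where j: "j < length bs" and "bin_load (bs ! j) > 1/2" "bin_load (bs ! j) + x \<le> 1"
    and step: "best_fit_step bs x = bs[j := bs ! j @ [x]]"
    and first: "\<forall>i<j. bin_load (bs ! i) + x \<le> 1 \<longrightarrow> bin_load (bs ! i) < bin_load (bs ! j)"
    by (rule small_step[OF x])
  have "j \<noteq> c" using first[rule_format, of a] fit Cons.prems(3,5) by auto
  have ld: "bin_load (best_fit_step bs x ! i) = bin_load (bs ! i) + (if i = j then x else 0)"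
    if "i < length bs" for i using that by (simp add: step nth_list_update)
  have "bin_load (foldl best_fit_step (best_fit_step bs x) s ! c) = bin_load (best_fit_step bs x ! c)"
  proof (rule Cons.IH)
    show "c < length (best_fit_step bs x)" using Cons.prems(4) step by simp
    show "bin_load (best_fit_step bs x ! c) \<le> bin_load (best_fit_step bs x ! a)"
      using Cons.prems(3-5) ld[of c] ld[of a] \<open>j \<noteq> c\<close> x(1) by auto
    show "bin_load (best_fit_step bs x ! a) + sum_list s \<le> 1"
      using Cons.prems(3,4,6) ld[of a] x(1) by auto
  qed (use Cons.prems in auto)
  then show ?case using ld[of c] Cons.prems(4) \<open>j \<noteq> c\<close> by simp
qed

text \<open>Peels off the small items before the next big one, so that a block can be followed one
  big item at a time with all invariants restored.\<close>

lemma calm_next_big: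
  assumes "calm bs w" "half_full bs" "\<forall>x\<in>set w. 0 < x" "filter (\<lambda>x. x > 8/25) w = y # ys"
  obtains s w' where "w = s @ y # w'" "\<forall>x\<in>set s. 0 < x \<and> x \<le> 8/25" "filter (\<lambda>x. x > 8/25) w' = ys"
    "y > 8/25" "calm bs s" "\<not> gainful (foldl best_fit_step bs s) y" "half_full (foldl best_fit_step bs s)"
    "calm (best_fit_step (foldl best_fit_step bs s) y) w'"
    "half_full (best_fit_step (foldl best_fit_step bs s) y)" "\<forall>x\<in>set w'. 0 < x"
proof -
  obtain s w' where w: "w = s @ y # w'" "\<forall>u\<in>set s. \<not> u > 8/25" "y > 8/25" "ys = filter (\<lambda>x. x > 8/25) w'"
    using assms(4) unfolding filter_eq_Cons_iff by blast
  have h: "half_full (foldl best_fit_step bs s)" using half_full_run[OF assms(2)] assms(3) w(1) by simp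
  show ?thesis
    using that[OF w(1) _ w(4)[symmetric] w(3) _ _ h] half_full_step[OF h, of y] w(2) assms(1,3)
    unfolding w(1) calm_append by (simp add: not_less)
qed

text \<open>Without a low bin at the start, m1 and m2 share a bin a, and m3 and m4 share a bin c. As
  sizes descend, a is at least as full as c; having at most 2/3 from m1 and m2, it also has room for
  the permitted small volume, so small items before m5 avoid c. Hence c holds exactly m3 + m4, which
  exceeds 1/2, and m5 still fits because all three are at most 1/3: a gain.\<close>

lemma descending_block_not_calm_aux:
  assumes "half_full bs" "\<forall>x\<in>set w. 0 < x" "low_loads bs = {}"
    and big: "filter (\<lambda>x. x > 8/25) w = m1 # m2 # m3 # m4 # m5 # ms"
    and ord: "m1 \<le> 1/3" "m2 \<le> m1" "m3 \<le> m2" "m4 \<le> m3" "m5 \<le> m4"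
    and vol: "sum_list (filter (\<lambda>x. x \<le> 8/25) w) \<le> 1/3"
  shows "\<not> calm bs w"
proof
  assume c: "calm bs w"
  define run where "run = foldl best_fit_step"
  obtain s1 w1 where 1: "w = s1 @ m1 # w1" "\<forall>x\<in>set s1. 0 < x \<and> x \<le> 8/25"
    "filter (\<lambda>x. x > 8/25) w1 = m2 # m3 # m4 # m5 # ms" "m1 > 8/25" "calm bs s1"
    "\<not> gainful (run bs s1) m1" "half_full (run bs s1)"
    "calm (best_fit_step (run bs s1) m1) w1" "half_full (best_fit_step (run bs s1) m1)" "\<forall>x\<in>set w1. 0 < x"
    unfolding run_def by (rule calm_next_big[OF c assms(1,2) big])
  define b1 where "b1 = best_fit_step (run bs s1) m1"
  obtain s2 w2 where 2: "w1 = s2 @ m2 # w2" "\<forall>x\<in>set s2. 0 < x \<and> x \<le> 8/25"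
    "filter (\<lambda>x. x > 8/25) w2 = m3 # m4 # m5 # ms" "m2 > 8/25" "calm b1 s2"
    "\<not> gainful (run b1 s2) m2" "half_full (run b1 s2)"
    "calm (best_fit_step (run b1 s2) m2) w2" "half_full (best_fit_step (run b1 s2) m2)" "\<forall>x\<in>set w2. 0 < x"
    unfolding run_def b1_def by (rule calm_next_big[OF 1(8-10)[unfolded run_def] 1(3)])
  define b2 where "b2 = best_fit_step (run b1 s2) m2"
  obtain s3 w3 where 3: "w2 = s3 @ m3 # w3" "\<forall>x\<in>set s3. 0 < x \<and> x \<le> 8/25"
    "filter (\<lambda>x. x > 8/25) w3 = m4 # m5 # ms" "m3 > 8/25" "calm b2 s3"
    "\<not> gainful (run b2 s3) m3" "half_full (run b2 s3)"
    "calm (best_fit_step (run b2 s3) m3) w3" "half_full (best_fit_step (run b2 s3) m3)" "\<forall>x\<in>set w3. 0 < x"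
    unfolding run_def by (rule calm_next_big[OF 2(8-10)[folded b2_def] 2(3)])
  define b3 where "b3 = best_fit_step (run b2 s3) m3"
  obtain s4 w4 where 4: "w3 = s4 @ m4 # w4" "\<forall>x\<in>set s4. 0 < x \<and> x \<le> 8/25"
    "filter (\<lambda>x. x > 8/25) w4 = m5 # ms" "m4 > 8/25" "calm b3 s4"
    "\<not> gainful (run b3 s4) m4" "half_full (run b3 s4)"
    "calm (best_fit_step (run b3 s4) m4) w4" "half_full (best_fit_step (run b3 s4) m4)" "\<forall>x\<in>set w4. 0 < x"
    unfolding run_def by (rule calm_next_big[OF 3(8-10)[folded b3_def] 3(3)])
  define b4 where "b4 = best_fit_step (run b3 s4) m4"
  obtain s5 w5 where 5: "w4 = s5 @ m5 # w5" "\<forall>x\<in>set s5. 0 < x \<and> x \<le> 8/25"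
    "filter (\<lambda>x. x > 8/25) w5 = ms" "m5 > 8/25" "calm b4 s5"
    "\<not> gainful (run b4 s5) m5" "half_full (run b4 s5)"
    "calm (best_fit_step (run b4 s5) m5) w5" "half_full (best_fit_step (run b4 s5) m5)" "\<forall>x\<in>set w5. 0 < x"
    unfolding run_def by (rule calm_next_big[OF 4(8-10)[folded b4_def] 4(3)])
  have fs: "filter (\<lambda>x. x \<le> 8/25) s = s" if "\<forall>x\<in>set s. 0 < x \<and> x \<le> 8/25" for s :: "real list"
    using that by (simp add: filter_id_conv)
  have "sum_list (filter (\<lambda>x. x \<le> 8/25) w5) \<ge> 0"
    using 5(10) by (intro sum_list_nonneg) (auto intro: less_imp_le)
  moreover have nn: "sum_list s \<ge> 0" if "\<forall>x\<in>set s. 0 < x \<and> x \<le> 8/25" for s :: "real list"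
    using that by (intro sum_list_nonneg) (auto intro: less_imp_le)
  \<comment> \<open>Only small items after m2 can reach bin a: earlier it is not yet open or at most
    half full. So \<open>s1\<close> and \<open>s2\<close> are dropped from the sum.\<close>
  ultimately have sv: "sum_list s3 + sum_list s4 + sum_list s5 \<le> 1/3"
    using vol nn[OF 1(2)] nn[OF 2(2)] fs[OF 1(2)] fs[OF 2(2)] fs[OF 3(2)] fs[OF 4(2)] fs[OF 5(2)]
      1(4) 2(4) 3(4) 4(4) 5(4)
    by (simp add: 1(1) 2(1) 3(1) 4(1) 5(1))
  note sr = small_run[folded run_def]
  \<comment> \<open>The bin opened by m1 goes to the end of the list, so its index is below that of
    the bin c opened later, as the tie-breaking in \<open>small_run_shielded\<close>
    requires.\<close>
  define a where "a = length (run bs s1)"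
  have b1: "b1 = run bs s1 @ [[m1]]"
    using medium_step_new(2)[OF 1(4,6)] sr(2)[OF 1(5,2)] assms(3) by (simp add: b1_def)
  have a1: "a < length b1" "bin_load (b1 ! a) = m1" by (simp_all add: b1 a_def)
  have a1': "a < length (run b1 s2)" "bin_load (run b1 s2 ! a) = m1"
    using sr(1,5)[OF 2(5,2)] a1 ord(1) by simp_all
  have b2: "b2 = (run b1 s2)[a := run b1 s2 ! a @ [m2]]"
    unfolding b2_def using medium_step_join[OF 2(7,4) _ 2(6) a1'(1)] a1'(2) ord by simp
  have a2: "a < length b2" "bin_load (b2 ! a) = m1 + m2" using a1' by (simp_all add: b2)
  \<comment> \<open>Two medium items exceed 1/2, so bin a is no longer low and m3 has to open a new
    bin.\<close>
  have low2: "low_loads b2 = {}"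
    using low_loads_fill[OF 2(7) a1'(1), of m2] a1'(2) ord 1(4) 2(4) by (simp add: b2)
  have a3: "a < length (run b2 s3)" "m1 + m2 \<le> bin_load (run b2 s3 ! a)"
    "bin_load (run b2 s3 ! a) \<le> m1 + m2 + sum_list s3"
    using sr(1)[OF 3(5,2)] sr(3,4)[OF 3(5,2) a2(1)] a2 by simp_all
  define c where "c = length (run b2 s3)"
  have b3: "b3 = run b2 s3 @ [[m3]]"
    using medium_step_new(2)[OF 3(4,6)] sr(2)[OF 3(5,2)] low2 by (simp add: b3_def)
  have ac: "a < c" using a3(1) by (simp add: c_def)
  have b3a: "b3 ! a = run b2 s3 ! a" using ac by (simp add: b3 c_def nth_append)
  have c3: "c < length b3" "bin_load (b3 ! c) = m3" "a < length b3" using ac by (simp_all add: b3 c_def)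
  have c3': "c < length (run b3 s4)" "bin_load (run b3 s4 ! c) = m3"
    using sr(1,5)[OF 4(5,2)] c3 ord by simp_all
  have a4: "m1 + m2 \<le> bin_load (run b3 s4 ! a)" "bin_load (run b3 s4 ! a) \<le> m1 + m2 + sum_list s3 + sum_list s4"
    using sr(3,4)[OF 4(5,2) c3(3)] a3 b3a by simp_all
  have b4: "b4 = (run b3 s4)[c := run b3 s4 ! c @ [m4]]"
    unfolding b4_def using medium_step_join[OF 4(7,4) _ 4(6) c3'(1)] c3'(2) ord by simp
  have c4: "c < length b4" "bin_load (b4 ! c) = m3 + m4" "b4 ! a = run b3 s4 ! a"
    using c3' ac by (simp_all add: b4)
  have "bin_load (b4 ! a) + sum_list s5 \<le> 1" using a4 c4 sv ord by simp
  moreover have "bin_load (b4 ! c) \<le> bin_load (b4 ! a)" using a4 c4 ord by simp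
  ultimately have "bin_load (run b4 s5 ! c) = m3 + m4"
    using small_run_shielded[OF 5(5,2) ac c4(1)] c4(2) unfolding run_def by simp
  moreover have "c < length (run b4 s5)" using sr(1)[OF 5(5,2)] c4(1) by simp
  ultimately have "c \<in> fitting_bins (run b4 s5) m5" "bin_load (run b4 s5 ! c) > 1/2"
    using ord 3(4) 4(4) by (simp_all add: fitting_bins_def)
  then show False using 5(4,6) unfolding gainful_def by blast
qed

text \<open>The two extra items absorb a low bin left over from before the block: m1, or m1 and m2
  together, lift it above 1/2, and five descending items still remain.\<close>

lemma descending_block_not_calm:
  assumes "half_full bs" "\<forall>x\<in>set w. 0 < x"
    and big: "filter (\<lambda>x. x > 8/25) w = [m1, m2, m3, m4, m5, m6, m7]"
    and ord: "m1 \<le> 1/3" "m2 \<le> m1" "m3 \<le> m2" "m4 \<le> m3" "m5 \<le> m4" "m6 \<le> m5" "m7 \<le> m6"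
    and vol: "sum_list (filter (\<lambda>x. x \<le> 8/25) w) \<le> 1/3"
  shows "\<not> calm bs w"
proof
  assume c: "calm bs w"
  have suffix_vol: "sum_list (filter (\<lambda>x. x \<le> 8/25) w') \<le> sum_list (filter (\<lambda>x. x \<le> 8/25) (s @ y # w'))"
    if "\<forall>x\<in>set s. 0 < x \<and> x \<le> 8/25" "y > 8/25" for w' s :: "real list" and y
  proof -
    have "sum_list (filter (\<lambda>x. x \<le> 8/25) s) \<ge> 0"
      using that(1) by (intro sum_list_nonneg) (auto intro: less_imp_le)
    then show ?thesis using that(2) by simp
  qed
  show False
  proof (cases rule: set_option_low_loads[OF assms(1)])
    case 1
    then show ?thesis using descending_block_not_calm_aux[OF assms(1,2) _ big ord(1-5) vol] c by simp
  next
    case (2 l)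
    obtain s1 w1 where 1: "w = s1 @ m1 # w1" "\<forall>x\<in>set s1. 0 < x \<and> x \<le> 8/25"
      "filter (\<lambda>x. x > 8/25) w1 = [m2, m3, m4, m5, m6, m7]" "m1 > 8/25" "calm bs s1"
      "\<not> gainful (foldl best_fit_step bs s1) m1" "half_full (foldl best_fit_step bs s1)"
      "calm (best_fit_step (foldl best_fit_step bs s1) m1) w1"
      "half_full (best_fit_step (foldl best_fit_step bs s1) m1)" "\<forall>x\<in>set w1. 0 < x"
      by (rule calm_next_big[OF c assms(1,2) big])
    define b1 where "b1 = best_fit_step (foldl best_fit_step bs s1) m1"
    obtain s2 w2 where 3: "w1 = s2 @ m2 # w2" "\<forall>x\<in>set s2. 0 < x \<and> x \<le> 8/25"
      "filter (\<lambda>x. x > 8/25) w2 = [m3, m4, m5, m6, m7]" "m2 > 8/25" "calm b1 s2"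
      "\<not> gainful (foldl best_fit_step b1 s2) m2" "half_full (foldl best_fit_step b1 s2)"
      "calm (best_fit_step (foldl best_fit_step b1 s2) m2) w2"
      "half_full (best_fit_step (foldl best_fit_step b1 s2) m2)" "\<forall>x\<in>set w2. 0 < x"
      unfolding b1_def by (rule calm_next_big[OF 1(8-10) 1(3)])
    define b2 where "b2 = best_fit_step (foldl best_fit_step b1 s2) m2"
    have v1: "sum_list (filter (\<lambda>x. x \<le> 8/25) w1) \<le> 1/3"
      using suffix_vol[OF 1(2,4), of w1] vol 1(1) by simp
    then have v2: "sum_list (filter (\<lambda>x. x \<le> 8/25) w2) \<le> 1/3"
      using suffix_vol[OF 3(2,4), of w2] 3(1) by simp
    have l1: "low_loads b1 = set_option (if l + m1 \<le> 1/2 then Some (l + m1) else None)"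
      using low_loads_medium_step[OF 1(7,4) _ 1(6), of "Some l"] small_run(2)[OF 1(5,2)] 2(1) ord
      by (simp add: b1_def)
    show False
    proof (cases "l + m1 \<le> 1/2")
      case True
      then have "low_loads b2 = {}"
        using low_loads_medium_step[OF 3(7,4) _ 3(6), of "Some (l + m1)"] small_run(2)[OF 3(5,2)] l1 ord
          1(4) 3(4) 2(2) by (simp add: b2_def)
      then show False
        using descending_block_not_calm_aux[OF 3(9,10)[folded b2_def] _ 3(3) _ ord(4-7) v2] ord 3(8)[folded b2_def]
        by simp
    next
      case False
      then have "low_loads b1 = {}" using l1 by simp
      then show False
        using descending_block_not_calm_aux[OF 1(9,10)[folded b1_def] _ 1(3) _ ord(3-6) v1] ord 1(8)[folded b1_def]
        by simp
    qed
  qed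
qed

lemma calm_state_at:
  assumes "lo \<le> hi" "hi \<le> length J"
  shows "calm (state_at J lo) (map ((!) J) [lo..<hi]) \<longleftrightarrow>
    (\<forall>p\<in>{lo..<hi}. \<not> wasteful (state_at J p) (J ! p) \<and> \<not> gainful (state_at J p) (J ! p))"
proof -
  have "foldl best_fit_step (state_at J lo) (map ((!) J) [lo..<hi]) = state_at J hi \<and>
    (calm (state_at J lo) (map ((!) J) [lo..<hi]) \<longleftrightarrow>
    (\<forall>p\<in>{lo..<hi}. \<not> wasteful (state_at J p) (J ! p) \<and> \<not> gainful (state_at J p) (J ! p)))"
    using assms
  proof (induction hi rule: dec_induct)
    case base
    then show ?case by simp
  next
    case (step hi)
    then show ?case by (simp add: calm_append state_at_Suc atLeastLessThanSuc) blast
  qed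
  then show ?thesis by blast
qed

section \<open>Averages over permutations\<close>

definition perm_avg :: "nat \<Rightarrow> ((nat \<Rightarrow> nat) \<Rightarrow> real) \<Rightarrow> real" where
  "perm_avg n F = (\<Sum>\<sigma> | \<sigma> permutes {..<n}. F \<sigma>) / fact n"

lemma finite_perms [simp]: "finite {\<sigma>. \<sigma> permutes {..<n::nat}}"
  by (simp add: finite_permutations)

lemma card_perms: "card {\<sigma>. \<sigma> permutes {..<n::nat}} = fact n"
  by (simp add: card_permutations)

lemma random_order_expectation_eq_perm_avg:
  "random_order_expectation A I = perm_avg (length I) (\<lambda>\<sigma>. real (A (permute_list \<sigma> I)))"
proof -
  have "{\<sigma>. \<sigma> permutes {..<length I}} \<noteq> {}" using permutes_id by blast
  then show ?thesis
    by (simp add: random_order_expectation_def perm_avg_def integral_pmf_of_set card_perms)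
qed

lemma perm_avg_mono:
  "(\<And>\<sigma>. \<sigma> permutes {..<n} \<Longrightarrow> F \<sigma> \<le> G \<sigma>) \<Longrightarrow> perm_avg n F \<le> perm_avg n G"
  unfolding perm_avg_def by (intro divide_right_mono sum_mono) auto

lemma perm_avg_cong:
  "(\<And>\<sigma>. \<sigma> permutes {..<n} \<Longrightarrow> F \<sigma> = G \<sigma>) \<Longrightarrow> perm_avg n F = perm_avg n G"
  unfolding perm_avg_def by (auto intro!: sum.cong arg_cong2[where f = "(/)"])

lemma perm_avg_add: "perm_avg n (\<lambda>\<sigma>. F \<sigma> + G \<sigma>) = perm_avg n F + perm_avg n G"
  by (simp add: perm_avg_def sum.distrib add_divide_distrib)

lemma perm_avg_diff: "perm_avg n (\<lambda>\<sigma>. F \<sigma> - G \<sigma>) = perm_avg n F - perm_avg n G"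
  by (simp add: perm_avg_def sum_subtractf diff_divide_distrib)

lemma perm_avg_cmult: "perm_avg n (\<lambda>\<sigma>. c * F \<sigma>) = c * perm_avg n F"
  by (simp add: perm_avg_def flip: sum_distrib_left)

lemma perm_avg_const [simp]: "perm_avg n (\<lambda>_. c) = c"
  by (simp add: perm_avg_def card_perms)

lemma perm_avg_sum: "perm_avg n (\<lambda>\<sigma>. \<Sum>i\<in>A. F i \<sigma>) = (\<Sum>i\<in>A. perm_avg n (F i))"
  unfolding perm_avg_def by (subst sum.swap) (simp add: sum_divide_distrib)

lemma perm_avg_compose:
  "\<tau> permutes {..<n} \<Longrightarrow> perm_avg n (\<lambda>\<sigma>. F (\<sigma> \<circ> \<tau>)) = perm_avg n F"
  unfolding perm_avg_def using sum_permutations_compose_right[of \<tau> "{..<n}" F] by simp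

lemma sum_permuted: "\<sigma> permutes {..<n} \<Longrightarrow> (\<Sum>i<n. f (\<sigma> i)) = (\<Sum>i<n. f i)" for f :: "nat \<Rightarrow> real"
  using sum.permute[of \<sigma> "{..<n}" f] by simp

text \<open>Composing with a transposition makes all positions alike, and the sum over all positions
  does not depend on the permutation.\<close>

lemma perm_avg_single:
  assumes "i < n"
  shows "perm_avg n (\<lambda>\<sigma>. f (\<sigma> i)) = (\<Sum>j<n. f j) / real n"
proof -
  have "perm_avg n (\<lambda>\<sigma>. f (\<sigma> j)) = perm_avg n (\<lambda>\<sigma>. f (\<sigma> i))" if "j < n" for j
    using perm_avg_compose[of "Transposition.transpose i j" n "\<lambda>\<sigma>. f (\<sigma> i)"] assms that
    by (simp add: permutes_swap_id)
  then have "real n * perm_avg n (\<lambda>\<sigma>. f (\<sigma> i)) = (\<Sum>j<n. perm_avg n (\<lambda>\<sigma>. f (\<sigma> j)))" by simp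
  also have "\<dots> = perm_avg n (\<lambda>\<sigma>. \<Sum>j<n. f (\<sigma> j))" by (simp add: perm_avg_sum)
  also have "\<dots> = perm_avg n (\<lambda>_. \<Sum>j<n. f j)" by (intro perm_avg_cong sum_permuted)
  finally show ?thesis using assms by (simp add: field_simps)
qed

text \<open>For centred values two different positions are negatively correlated, because the values at
  all positions other than i sum to minus the value at i.\<close>

lemma perm_avg_pair_nonpos:
  assumes "i < n" "j < n" "i \<noteq> j" "(\<Sum>k<n. h k) = 0"
  shows "perm_avg n (\<lambda>\<sigma>. h (\<sigma> i) * h (\<sigma> j)) \<le> 0"
proof -
  let ?c = "\<lambda>k. perm_avg n (\<lambda>\<sigma>. h (\<sigma> i) * h (\<sigma> k))"
  have eq: "?c k = ?c j" if "k \<in> {..<n} - {i}" for k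
    using perm_avg_compose[of "Transposition.transpose j k" n "\<lambda>\<sigma>. h (\<sigma> i) * h (\<sigma> j)"] assms that
    by (simp add: permutes_swap_id)
  have "(\<Sum>k\<in>{..<n} - {i}. ?c k) = real (card ({..<n} - {i})) * ?c j"
    using eq by simp
  then have "real (n - 1) * ?c j = (\<Sum>k\<in>{..<n} - {i}. ?c k)" using assms(1) by simp
  also have "\<dots> = perm_avg n (\<lambda>\<sigma>. h (\<sigma> i) * (\<Sum>k\<in>{..<n} - {i}. h (\<sigma> k)))"
    by (simp add: perm_avg_sum sum_distrib_left)
  also have "\<dots> = perm_avg n (\<lambda>\<sigma>. h (\<sigma> i) * - h (\<sigma> i))"
  proof (rule perm_avg_cong)
    fix \<sigma> assume "\<sigma> permutes {..<n}"
    then have "(\<Sum>k<n. h (\<sigma> k)) = 0" using sum_permuted[of \<sigma> n h] assms(4) by simp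
    then have "(\<Sum>k\<in>{..<n} - {i}. h (\<sigma> k)) = - h (\<sigma> i)" using assms(1) by (simp add: sum_diff1)
    then show "h (\<sigma> i) * (\<Sum>k\<in>{..<n} - {i}. h (\<sigma> k)) = h (\<sigma> i) * - h (\<sigma> i)" by simp
  qed
  also have "\<dots> \<le> perm_avg n (\<lambda>_. 0)" by (intro perm_avg_mono) simp
  finally have "real (n - 1) * ?c j \<le> 0" by simp
  moreover have "real (n - 1) > 0" using assms(1-3) by simp
  ultimately show ?thesis by (simp add: mult_le_0_iff)
qed

text \<open>This is sampling without replacement: after centring, the mixed terms are nonpositive by
  \<open>perm_avg_pair_nonpos\<close>, so only the diagonal counts, and centring does not increase
  the sum of squares.\<close>

lemma perm_avg_prefix_variance:
  fixes f :: "nat \<Rightarrow> real"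
  assumes "p \<le> n" "n > 0"
  shows "perm_avg n (\<lambda>\<sigma>. ((\<Sum>i<p. f (\<sigma> i)) - real p / real n * (\<Sum>i<n. f i))\<^sup>2) \<le> (\<Sum>i<n. (f i)\<^sup>2)"
proof -
  define S where "S = (\<Sum>i<n. f i)"
  define h where "h i = f i - S / real n" for i
  have h0: "(\<Sum>i<n. h i) = 0" using assms(2) by (simp add: h_def sum_subtractf S_def)
  have "((\<Sum>i<p. f (\<sigma> i)) - real p / real n * S)\<^sup>2 = (\<Sum>i<p. \<Sum>j<p. h (\<sigma> i) * h (\<sigma> j))" for \<sigma>
  proof -
    have "(\<Sum>i<p. f (\<sigma> i)) - real p / real n * S = (\<Sum>i<p. h (\<sigma> i))" by (simp add: h_def sum_subtractf)
    then show ?thesis by (simp add: power2_eq_square sum_product)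
  qed
  then have "perm_avg n (\<lambda>\<sigma>. ((\<Sum>i<p. f (\<sigma> i)) - real p / real n * S)\<^sup>2)
    = (\<Sum>i<p. \<Sum>j<p. perm_avg n (\<lambda>\<sigma>. h (\<sigma> i) * h (\<sigma> j)))"
    by (simp add: perm_avg_sum)
  also have "\<dots> \<le> (\<Sum>i<p. \<Sum>j<p. if j = i then (\<Sum>k<n. (h k)\<^sup>2) / real n else 0)"
  proof (intro sum_mono)
    fix i j assume ij: "i \<in> {..<p}" "j \<in> {..<p}"
    show "perm_avg n (\<lambda>\<sigma>. h (\<sigma> i) * h (\<sigma> j)) \<le> (if j = i then (\<Sum>k<n. (h k)\<^sup>2) / real n else 0)"
    proof (cases "j = i")
      case True
      then show ?thesis using perm_avg_single[of i n "\<lambda>k. (h k)\<^sup>2"] ij assms(1) by (simp add: power2_eq_square)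
    next
      case False
      then show ?thesis using perm_avg_pair_nonpos[of i n j h] ij assms(1) h0 by simp
    qed
  qed
  also have "\<dots> = real p / real n * (\<Sum>k<n. (h k)\<^sup>2)" by (simp add: sum.delta)
  also have "\<dots> \<le> 1 * (\<Sum>k<n. (h k)\<^sup>2)"
    using assms by (intro mult_right_mono sum_nonneg) auto
  also have "(\<Sum>k<n. (h k)\<^sup>2) = (\<Sum>k<n. (f k)\<^sup>2) - S\<^sup>2 / real n"
  proof -
    have "(\<Sum>k<n. (h k)\<^sup>2) = (\<Sum>k<n. (f k)\<^sup>2 - 2 * (S / real n) * f k + (S / real n)\<^sup>2)"
      by (simp add: h_def power2_diff algebra_simps)
    also have "\<dots> = (\<Sum>k<n. (f k)\<^sup>2) - 2 * (S / real n) * S + real n * (S / real n)\<^sup>2"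
      unfolding sum.distrib sum_subtractf sum_distrib_left[symmetric] S_def[symmetric] by simp
    also have "\<dots> = (\<Sum>k<n. (f k)\<^sup>2) - S\<^sup>2 / real n"
      using assms(2) by (simp add: power2_eq_square field_simps)
    finally show ?thesis .
  qed
  finally show ?thesis unfolding S_def by (smt (verit) divide_nonneg_nonneg of_nat_0_le_iff zero_le_power2)
qed

lemma perm_avg_prefix_deviation:
  fixes f :: "nat \<Rightarrow> real"
  assumes "p \<le> n" "n > 0" "(\<Sum>i<n. (f i)\<^sup>2) \<le> v" "v > 0"
  shows "perm_avg n (\<lambda>\<sigma>. \<bar>(\<Sum>i<p. f (\<sigma> i)) - real p / real n * (\<Sum>i<n. f i)\<bar>) \<le> sqrt v"
proof -
  let ?D = "\<lambda>\<sigma>. (\<Sum>i<p. f (\<sigma> i)) - real p / real n * (\<Sum>i<n. f i)"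
  have s: "sqrt v > 0" "sqrt v * sqrt v = v" using assms(4) by auto
  \<comment> \<open>The inequality of arithmetic and geometric means takes the place of Jensen; the
    weight sqrt v balances the two terms.\<close>
  have "\<bar>d\<bar> \<le> 1 / (2 * sqrt v) * d\<^sup>2 + sqrt v / 2" for d
  proof -
    have "0 \<le> (\<bar>d\<bar> - sqrt v)\<^sup>2" by simp
    also have "\<dots> = d\<^sup>2 + v - 2 * \<bar>d\<bar> * sqrt v" using s by (simp add: power2_diff power2_eq_square[of "sqrt v"])
    finally show ?thesis using s by (simp add: field_simps)
  qed
  then have "perm_avg n (\<lambda>\<sigma>. \<bar>?D \<sigma>\<bar>) \<le> perm_avg n (\<lambda>\<sigma>. 1 / (2 * sqrt v) * (?D \<sigma>)\<^sup>2 + sqrt v / 2)"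
    by (intro perm_avg_mono)
  also have "\<dots> = 1 / (2 * sqrt v) * perm_avg n (\<lambda>\<sigma>. (?D \<sigma>)\<^sup>2) + sqrt v / 2"
    by (simp only: perm_avg_add perm_avg_cmult perm_avg_const)
  also have "\<dots> \<le> 1 / (2 * sqrt v) * v + sqrt v / 2"
    using perm_avg_prefix_variance[OF assms(1,2), of f] assms(3) s(1)
    by (intro add_right_mono mult_left_mono) auto
  also have "\<dots> = sqrt v" using s by (simp add: field_simps)
  finally show ?thesis .
qed

section \<open>Big items in random order\<close>

definition big_positions :: "nat \<Rightarrow> nat set \<Rightarrow> (nat \<Rightarrow> nat) \<Rightarrow> nat list" where
  "big_positions n B \<sigma> = filter (\<lambda>p. \<sigma> p \<in> B) [0..<n]"

lemma set_big_positions: "set (big_positions n B \<sigma>) = {p. p < n \<and> \<sigma> p \<in> B}"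
  by (auto simp: big_positions_def)

lemma distinct_big_positions: "distinct (big_positions n B \<sigma>)"
  by (simp add: big_positions_def)

lemma length_big_positions:
  assumes "\<sigma> permutes {..<n}" "B \<subseteq> {..<n}"
  shows "length (big_positions n B \<sigma>) = card B"
proof -
  have "length (big_positions n B \<sigma>) = card {p. p < n \<and> \<sigma> p \<in> B}"
    using distinct_card[OF distinct_big_positions, of n B \<sigma>] by (simp add: set_big_positions)
  also have "bij_betw \<sigma> {p. p < n \<and> \<sigma> p \<in> B} B"
  proof (rule bij_betwI')
    show "\<exists>x\<in>{p. p < n \<and> \<sigma> p \<in> B}. y = \<sigma> x" if "y \<in> B" for y
    proof -
      have "y \<in> \<sigma> ` {..<n}" using that assms(2) permutes_image[OF assms(1)] by auto
      then show ?thesis using that by auto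
    qed
  qed (use permutes_inj[OF assms(1)] in \<open>auto simp: inj_eq\<close>)
  then have "card {p. p < n \<and> \<sigma> p \<in> B} = card B" by (rule bij_betw_same_card)
  finally show ?thesis .
qed

lemma big_positions_less:
  "r < r' \<Longrightarrow> r' < length (big_positions n B \<sigma>) \<Longrightarrow> big_positions n B \<sigma> ! r < big_positions n B \<sigma> ! r'"
  by (rule sorted_wrt_nth_less) (simp_all add: big_positions_def sorted_wrt_filter)

lemma big_positions_nth:
  assumes "r < length (big_positions n B \<sigma>)"
  shows "big_positions n B \<sigma> ! r < n" "\<sigma> (big_positions n B \<sigma> ! r) \<in> B"
  using nth_mem[OF assms] unfolding set_big_positions by auto

lemma big_positions_le_iff:
  assumes "r < length (big_positions n B \<sigma>)" "r' < length (big_positions n B \<sigma>)"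
  shows "big_positions n B \<sigma> ! r \<le> big_positions n B \<sigma> ! r' \<longleftrightarrow> r \<le> r'"
  using big_positions_less[of r r' n B \<sigma>] big_positions_less[of r' r n B \<sigma>] assms
  by (cases r r' rule: linorder_cases) auto

text \<open>Both lists are strictly increasing, so equality of their sets suffices. This identifies
  the big items that arrive inside a block.\<close>

lemma filter_big_positions:
  assumes "a \<le> c" "c < length (big_positions n B \<sigma>)"
  shows "filter (\<lambda>p. \<sigma> p \<in> B) [big_positions n B \<sigma> ! a..<Suc (big_positions n B \<sigma> ! c)]
    = map ((!) (big_positions n B \<sigma>)) [a..<Suc c]" (is "?l = ?r")
proof -
  let ?q = "big_positions n B \<sigma>"
  have "set ?l = set ?r"
  proof (rule set_eqI)
    fix p
    have "p \<in> set ?l \<longleftrightarrow> p \<in> set ?q \<and> ?q ! a \<le> p \<and> p \<le> ?q ! c"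
      using big_positions_nth(1)[OF assms(2)] by (auto simp: set_big_positions)
    also have "\<dots> \<longleftrightarrow> (\<exists>r<length ?q. p = ?q ! r \<and> a \<le> r \<and> r \<le> c)"
      using big_positions_le_iff[OF _ assms(2)] big_positions_le_iff[OF order.strict_trans1[OF assms]]
      unfolding in_set_conv_nth by auto
    also have "\<dots> \<longleftrightarrow> p \<in> set ?r"
      using assms by (simp add: image_iff del: upt_Suc) (metis atLeastLessThan_iff less_Suc_eq_le order.strict_trans1)
    finally show "p \<in> set ?l \<longleftrightarrow> p \<in> set ?r" .
  qed
  moreover have "sorted ?r"
    using assms by (auto simp: sorted_wrt_iff_nth_less big_positions_le_iff simp del: upt_Suc)
  moreover have "distinct ?r"
    using assms distinct_big_positions[of n B \<sigma>] by (auto simp: distinct_map inj_on_def nth_eq_iff_index_eq simp del: upt_Suc)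
  moreover have "sorted ?l" "distinct ?l" by (simp_all add: sorted_wrt_filter del: upt_Suc)
  ultimately show ?thesis by (intro sorted_distinct_set_unique)
qed

text \<open>The source of exchangeability: an exchange of two big values is invisible to anything
  that depends only on where big items stand and on the values outside B.\<close>

lemma big_positions_swap:
  assumes "a \<in> B" "c \<in> B"
  shows "big_positions n B (Transposition.transpose a c \<circ> \<sigma>) = big_positions n B \<sigma>"
    and "Transposition.transpose a c v \<in> B \<longleftrightarrow> v \<in> B"
    and "v \<notin> B \<Longrightarrow> Transposition.transpose a c v = v"
proof -
  show 1: "Transposition.transpose a c v \<in> B \<longleftrightarrow> v \<in> B" for v
    using assms by (auto simp: Transposition.transpose_def)
  show "big_positions n B (Transposition.transpose a c \<circ> \<sigma>) = big_positions n B \<sigma>"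
    by (simp add: big_positions_def 1)
  show "v \<notin> B \<Longrightarrow> Transposition.transpose a c v = v"
    using assms by (auto simp: Transposition.transpose_def)
qed

context
  fixes n :: nat and B :: "nat set" and ok :: "(nat \<Rightarrow> nat) \<Rightarrow> bool" and A :: "nat \<Rightarrow> nat set" and r0 :: nat
begin

text \<open>\<open>ok\<close> stands for an event preserved by exchanging two big values; it is used
  for the event that a given block has little small volume.\<close>

definition matching :: "nat \<Rightarrow> (nat \<Rightarrow> nat) set" where
  "matching i = {\<sigma>. \<sigma> permutes {..<n} \<and> ok \<sigma> \<and> (\<forall>i'<i. \<sigma> (big_positions n B \<sigma> ! (r0 + i')) \<in> A i')}"

text \<open>Swapping the value at the next big position with a prescribed value a of the next class
  does not disturb the values already matched, and at most b permutations have the same result.\<close>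

lemma card_matching_step:
  assumes B: "B \<subseteq> {..<n}" and i: "r0 + i < card B" and A: "A i \<subseteq> B" "\<And>i'. i' < i \<Longrightarrow> A i' \<inter> A i = {}"
    and ok: "\<And>\<sigma> a c. ok \<sigma> \<Longrightarrow> a \<in> B \<Longrightarrow> c \<in> B \<Longrightarrow> ok (Transposition.transpose a c \<circ> \<sigma>)"
  shows "card (A i) * card (matching i) \<le> card B * card (matching (Suc i))"
proof -
  define q where "q \<sigma> = big_positions n B \<sigma> ! (r0 + i)" for \<sigma>
  have fin: "finite (matching i)" for i
    unfolding matching_def by (rule finite_subset[OF _ finite_perms[of n]]) auto
  have finB: "finite B" using B finite_subset by blast
  have qB: "\<sigma> (q \<sigma>) \<in> B" if "\<sigma> permutes {..<n}" for \<sigma>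
    unfolding q_def using big_positions_nth(2) i length_big_positions[OF that B] by simp
  have fib: "card (matching i) \<le> card B * card {\<sigma> \<in> matching i. \<sigma> (q \<sigma>) = a}" if a: "a \<in> A i" for a
  proof -
    \<comment> \<open>Recording the replaced value is what allows the transposition to be
      undone.\<close>
    let ?F = "\<lambda>\<sigma>. (\<sigma> (q \<sigma>), Transposition.transpose (\<sigma> (q \<sigma>)) a \<circ> \<sigma>)"
    have aB: "a \<in> B" using a A by blast
    have "inj_on ?F (matching i)"
    proof (rule inj_onI)
      fix \<sigma> \<sigma>' assume "?F \<sigma> = ?F \<sigma>'"
      then have v: "\<sigma> (q \<sigma>) = \<sigma>' (q \<sigma>')"
        and "Transposition.transpose (\<sigma> (q \<sigma>)) a \<circ> \<sigma> = Transposition.transpose (\<sigma>' (q \<sigma>')) a \<circ> \<sigma>'"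
        unfolding prod.inject by (rule conjunct1, rule conjunct2)
      then have "Transposition.transpose (\<sigma> (q \<sigma>)) a \<circ> \<sigma> = Transposition.transpose (\<sigma> (q \<sigma>)) a \<circ> \<sigma>'" by (simp only: v)
      then have "Transposition.transpose (\<sigma> (q \<sigma>)) a (\<sigma> x) = Transposition.transpose (\<sigma> (q \<sigma>)) a (\<sigma>' x)" for x
        unfolding comp_def by (rule fun_cong)
      then have "\<sigma> x = \<sigma>' x" for x by (rule injD[OF inj_transpose])
      then show "\<sigma> = \<sigma>'" by (rule ext)
    qed
    moreover have "?F ` matching i \<subseteq> B \<times> {\<sigma> \<in> matching i. \<sigma> (q \<sigma>) = a}"
    proof safe
      fix \<sigma> assume m: "\<sigma> \<in> matching i"
      let ?t = "Transposition.transpose (\<sigma> (q \<sigma>)) a \<circ> \<sigma>"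
      have p: "\<sigma> permutes {..<n}" and "ok \<sigma>" using m by (auto simp: matching_def)
      show vB: "\<sigma> (q \<sigma>) \<in> B" by (rule qB[OF p])
      have bp: "big_positions n B ?t = big_positions n B \<sigma>" using big_positions_swap(1) vB aB by blast
      have "q ?t = q \<sigma>" using bp unfolding q_def by simp
      then show "?t (q ?t) = a" by simp
      have "Transposition.transpose (\<sigma> (q \<sigma>)) a permutes {..<n}"
        using vB aB B by (intro permutes_swap_id) auto
      then have "?t permutes {..<n}" by (rule permutes_compose[OF p])
      moreover have "ok ?t" using ok[OF \<open>ok \<sigma>\<close> vB aB] .
      \<comment> \<open>Earlier big positions hold neither the replaced value, by injectivity, nor
        a, because the classes are disjoint.\<close>
      moreover have "?t (big_positions n B \<sigma> ! (r0 + i')) \<in> A i'" if i': "i' < i" for i'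
      proof -
        have *: "\<sigma> (big_positions n B \<sigma> ! (r0 + i')) \<in> A i'" using m i' by (simp add: matching_def)
        have "big_positions n B \<sigma> ! (r0 + i') < q \<sigma>"
          unfolding q_def using i' i length_big_positions[OF p B] by (intro big_positions_less) auto
        then have "\<sigma> (big_positions n B \<sigma> ! (r0 + i')) \<noteq> \<sigma> (q \<sigma>)"
          using permutes_inj[OF p] by (simp add: inj_eq)
        moreover have "\<sigma> (big_positions n B \<sigma> ! (r0 + i')) \<noteq> a" using * a A(2)[OF i'] by blast
        ultimately show ?thesis using * by (simp add: Transposition.transpose_def)
      qed
      ultimately show "?t \<in> matching i" by (simp add: matching_def bp)
    qed
    ultimately have "card (matching i) \<le> card (B \<times> {\<sigma> \<in> matching i. \<sigma> (q \<sigma>) = a})"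
      using fin finB by (intro card_inj_on_le) auto
    then show ?thesis by (simp add: card_cartesian_product)
  qed
  have "card (A i) * card (matching i) = (\<Sum>a\<in>A i. card (matching i))" by simp
  also have "\<dots> \<le> (\<Sum>a\<in>A i. card B * card {\<sigma> \<in> matching i. \<sigma> (q \<sigma>) = a})" by (intro sum_mono fib)
  also have "\<dots> = card B * card (\<Union>a\<in>A i. {\<sigma> \<in> matching i. \<sigma> (q \<sigma>) = a})"
    using fin[of i] finite_subset[OF A(1) finB]
    by (subst card_UN_disjoint) (auto simp: sum_distrib_left intro: rev_finite_subset)
  also have "(\<Union>a\<in>A i. {\<sigma> \<in> matching i. \<sigma> (q \<sigma>) = a}) \<subseteq> matching (Suc i)"
    by (auto simp: matching_def q_def less_Suc_eq)
  then have "card B * card (\<Union>a\<in>A i. {\<sigma> \<in> matching i. \<sigma> (q \<sigma>) = a}) \<le> card B * card (matching (Suc i))"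
    using fin by (intro mult_le_mono2 card_mono)
  finally show ?thesis .
qed

text \<open>Each prescribed class retains a fraction of at least \<open>h / card B\<close>; the
  product is cleared of denominators to stay in the naturals.\<close>

lemma card_matching:
  assumes B: "B \<subseteq> {..<n}" and k: "r0 + k \<le> card B"
    and A: "\<And>i. i < k \<Longrightarrow> A i \<subseteq> B" "\<And>i i'. i' < i \<Longrightarrow> i < k \<Longrightarrow> A i' \<inter> A i = {}"
    and h: "\<And>i. i < k \<Longrightarrow> h \<le> card (A i)"
    and ok: "\<And>\<sigma> a c. ok \<sigma> \<Longrightarrow> a \<in> B \<Longrightarrow> c \<in> B \<Longrightarrow> ok (Transposition.transpose a c \<circ> \<sigma>)"
  shows "h ^ k * card (matching 0) \<le> card B ^ k * card (matching k)"
proof -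
  have "i \<le> k \<Longrightarrow> h ^ i * card (matching 0) \<le> card B ^ i * card (matching i)" for i
  proof (induction i)
    case 0
    then show ?case by simp
  next
    case (Suc i)
    have "h ^ Suc i * card (matching 0) = h * (h ^ i * card (matching 0))" by simp
    also have "\<dots> \<le> h * (card B ^ i * card (matching i))" using Suc by (intro mult_le_mono2) auto
    also have "\<dots> = card B ^ i * (h * card (matching i))" by (simp add: ac_simps)
    also have "\<dots> \<le> card B ^ i * (card (A i) * card (matching i))"
      using h Suc.prems by (intro mult_le_mono2 mult_le_mono1) auto
    also have "\<dots> \<le> card B ^ i * (card B * card (matching (Suc i)))"
    proof (rule mult_le_mono2, rule card_matching_step[OF B])
      show "r0 + i < card B" using Suc.prems k by simp
      show "A i \<subseteq> B" using Suc.prems A(1) by simp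
      show "A i' \<inter> A i = {}" if "i' < i" for i' using Suc.prems A(2)[OF that] by simp
    qed (rule ok)
    finally show ?case by (simp add: ac_simps)
  qed
  then show ?thesis by blast
qed

end

section \<open>Blocks of consecutive big items\<close>

definition block_start :: "nat \<Rightarrow> nat set \<Rightarrow> nat \<Rightarrow> (nat \<Rightarrow> nat) \<Rightarrow> nat \<Rightarrow> nat" where
  "block_start n B k \<sigma> j = big_positions n B \<sigma> ! (k * j)"

definition block_last :: "nat \<Rightarrow> nat set \<Rightarrow> nat \<Rightarrow> (nat \<Rightarrow> nat) \<Rightarrow> nat \<Rightarrow> nat" where
  "block_last n B k \<sigma> j = big_positions n B \<sigma> ! (k * j + (k - 1))"

text \<open>The window ends with the last big item of the block, so small items between two blocks
  belong to neither.\<close>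

definition block_volume :: "nat \<Rightarrow> nat set \<Rightarrow> (nat \<Rightarrow> real) \<Rightarrow> nat \<Rightarrow> (nat \<Rightarrow> nat) \<Rightarrow> nat \<Rightarrow> real" where
  "block_volume n B s k \<sigma> j =
     (\<Sum>p | p \<in> {block_start n B k \<sigma> j..block_last n B k \<sigma> j} \<and> \<sigma> p \<notin> B. s (\<sigma> p))"

definition good_block ::
  "nat \<Rightarrow> nat set \<Rightarrow> (nat \<Rightarrow> real) \<Rightarrow> nat \<Rightarrow> real \<Rightarrow> (nat \<Rightarrow> nat set) \<Rightarrow> (nat \<Rightarrow> nat) \<Rightarrow> nat \<Rightarrow> bool" where
  "good_block n B s k v A \<sigma> j \<longleftrightarrow> j < card B div k \<and> block_volume n B s k \<sigma> j \<le> v \<and>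
     (\<forall>i<k. \<sigma> (big_positions n B \<sigma> ! (k * j + i)) \<in> A i)"

lemma block_index_less:
  fixes b k j i :: nat
  assumes "j < b div k" "i < k"
  shows "k * j + i < b"
proof -
  have "k * j + k \<le> k * (b div k)" using assms(1) by (metis Suc_leI mult_Suc_right add.commute mult_le_mono2)
  then show ?thesis using assms(2) by (metis add_less_cancel_left div_times_less_eq_dividend le_less_trans less_le_trans mult.commute)
qed

lemma block_volume_swap:
  assumes "a \<in> B" "c \<in> B"
  shows "block_volume n B s k (Transposition.transpose a c \<circ> \<sigma>) j = block_volume n B s k \<sigma> j"
  unfolding block_volume_def block_start_def block_last_def big_positions_swap(1)[OF assms]
  using big_positions_swap(2,3)[OF assms] by (intro sum.cong) auto

text \<open>The windows of different blocks are disjoint sets of positions.\<close>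

lemma sum_block_volume_le:
  assumes \<sigma>: "\<sigma> permutes {..<n}" and B: "B \<subseteq> {..<n}" and k: "k > 0" and s: "\<And>i. i < n \<Longrightarrow> s i \<ge> 0"
  shows "(\<Sum>j<card B div k. block_volume n B s k \<sigma> j) \<le> (\<Sum>i\<in>{..<n} - B. s i)"
proof -
  let ?S = "\<lambda>j. {p. p \<in> {block_start n B k \<sigma> j..block_last n B k \<sigma> j} \<and> \<sigma> p \<notin> B}"
  have len: "length (big_positions n B \<sigma>) = card B" by (rule length_big_positions[OF \<sigma> B])
  have lt: "block_last n B k \<sigma> j < n" if "j < card B div k" for j
    unfolding block_last_def using big_positions_nth(1) len block_index_less[OF that, of "k - 1"] k by simp
  have sep: "block_last n B k \<sigma> j < block_start n B k \<sigma> j'" if "j < j'" "j' < card B div k" for j j'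
    unfolding block_last_def block_start_def
  proof (rule big_positions_less)
    have "k * j + k \<le> k * j'" using that(1) by (metis Suc_leI mult_Suc_right add.commute mult_le_mono2)
    then show "k * j + (k - 1) < k * j'" using k by simp
    show "k * j' < length (big_positions n B \<sigma>)" using block_index_less[OF that(2) k] len by simp
  qed
  have disj: "?S j \<inter> ?S j' = {}" if "j < card B div k" "j' < card B div k" "j \<noteq> j'" for j j'
    using that sep[of j j'] sep[of j' j] by (cases j j' rule: linorder_cases) auto
  have "(\<Sum>j<card B div k. block_volume n B s k \<sigma> j) = (\<Sum>p\<in>(\<Union>j<card B div k. ?S j). s (\<sigma> p))"
    unfolding block_volume_def using disj by (subst sum.UNION_disjoint) auto
  also have "\<dots> \<le> (\<Sum>p | p < n \<and> \<sigma> p \<notin> B. s (\<sigma> p))"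
  proof (rule sum_mono2)
    show "(\<Union>j<card B div k. ?S j) \<subseteq> {p. p < n \<and> \<sigma> p \<notin> B}" using lt by fastforce
    show "0 \<le> s (\<sigma> p)" if "p \<in> {p. p < n \<and> \<sigma> p \<notin> B} - (\<Union>j<card B div k. ?S j)" for p
      using that s[of "\<sigma> p"] permutes_in_image[OF \<sigma>, of p] by simp
  qed simp
  also have "\<dots> = (\<Sum>p<n. if \<sigma> p \<notin> B then s (\<sigma> p) else 0)"
    by (subst sum.inter_filter[symmetric]) (auto intro: sum.cong)
  also have "\<dots> = (\<Sum>i<n. if i \<notin> B then s i else 0)" by (rule sum_permuted[OF \<sigma>])
  also have "\<dots> = (\<Sum>i\<in>{..<n} - B. s i)"
    by (subst sum.inter_filter[symmetric]) (auto intro: sum.cong)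
  finally show ?thesis .
qed

text \<open>Markov's inequality over the blocks of one permutation: a heavy block uses up more than
  v of the total small volume.\<close>

lemma card_light_blocks:
  assumes \<sigma>: "\<sigma> permutes {..<n}" and B: "B \<subseteq> {..<n}" and k: "k > 0" and s: "\<And>i. i < n \<Longrightarrow> s i \<ge> 0"
    and v: "v > 0"
  shows "real (card B div k) - (\<Sum>i\<in>{..<n} - B. s i) / v
    \<le> real (card {j. j < card B div k \<and> block_volume n B s k \<sigma> j \<le> v})"
proof -
  let ?N = "card B div k"
  let ?H = "{j. j < ?N \<and> \<not> block_volume n B s k \<sigma> j \<le> v}"
  let ?L = "{j. j < ?N \<and> block_volume n B s k \<sigma> j \<le> v}"
  have nn: "block_volume n B s k \<sigma> j \<ge> 0" if "j < ?N" for j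
  proof -
    have "block_last n B k \<sigma> j < n"
      unfolding block_last_def
      using big_positions_nth(1) length_big_positions[OF \<sigma> B] block_index_less[OF that, of "k - 1"] k by simp
    then show ?thesis unfolding block_volume_def
      using s permutes_in_image[OF \<sigma>] by (intro sum_nonneg) auto
  qed
  have "v * real (card ?H) \<le> (\<Sum>j\<in>?H. block_volume n B s k \<sigma> j)"
    by (subst mult.commute, intro sum_bounded_below) auto
  also have "\<dots> \<le> (\<Sum>j<?N. block_volume n B s k \<sigma> j)" using nn by (intro sum_mono2) auto
  also have "\<dots> \<le> (\<Sum>i\<in>{..<n} - B. s i)" by (rule sum_block_volume_le[OF \<sigma> B k s])
  finally have "real (card ?H) \<le> (\<Sum>i\<in>{..<n} - B. s i) / v" using v by (simp add: field_simps)
  moreover have "?N \<le> card ?H + card ?L"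
    using card_Un_le[of ?H ?L] card_mono[of "?H \<union> ?L" "{..<?N}"] by fastforce
  ultimately show ?thesis by linarith
qed

text \<open>Linearity over the blocks. Exchanging big values does not affect whether a block is
  light, so among the permutations with a light j-th block a fraction of at least
  \<open>(h / card B) ^ k\<close> also matches the classes.\<close>

lemma perm_avg_good_blocks:
  assumes B: "B \<subseteq> {..<n}" "B \<noteq> {}" and k: "k > 0" and s: "\<And>i. i < n \<Longrightarrow> s i \<ge> 0" and v: "v > 0"
    and A: "\<And>i. i < k \<Longrightarrow> A i \<subseteq> B" "\<And>i i'. i' < i \<Longrightarrow> i < k \<Longrightarrow> A i' \<inter> A i = {}"
    and h: "\<And>i. i < k \<Longrightarrow> h \<le> card (A i)"
  shows "(real h / real (card B)) ^ k * (real (card B div k) - (\<Sum>i\<in>{..<n} - B. s i) / v)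
    \<le> perm_avg n (\<lambda>\<sigma>. real (card {j. good_block n B s k v A \<sigma> j}))"
proof -
  let ?N = "card B div k" and ?P = "{\<sigma>. \<sigma> permutes {..<n}}"
  let ?ok = "\<lambda>j \<sigma>. block_volume n B s k \<sigma> j \<le> v"
  have b: "card B > 0" using B finite_subset card_gt_0_iff by blast
  have count: "perm_avg n (\<lambda>\<sigma>. real (card {j. j < ?N \<and> Q j \<sigma>})) = (\<Sum>j<?N. real (card {\<sigma>\<in>?P. Q j \<sigma>})) / fact n" for Q
  proof -
    have 1: "real (card {j. j < ?N \<and> Q j \<sigma>}) = (\<Sum>j<?N. if Q j \<sigma> then 1 else 0)" for \<sigma>
      by (simp add: sum.If_cases Int_def)
    have 2: "(\<Sum>\<sigma>\<in>?P. if Q j \<sigma> then 1 else 0) = real (card {\<sigma>\<in>?P. Q j \<sigma>})" for j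
      by (simp add: sum.If_cases Int_def)
    show ?thesis unfolding perm_avg_def 1 2[symmetric] by (subst sum.swap) (rule refl)
  qed
  have step: "(real h / real (card B)) ^ k * real (card {\<sigma>\<in>?P. ?ok j \<sigma>})
    \<le> real (card {\<sigma>\<in>?P. ?ok j \<sigma> \<and> (\<forall>i<k. \<sigma> (big_positions n B \<sigma> ! (k * j + i)) \<in> A i)})" if j: "j < ?N" for j
  proof -
    have "k * j + (k - 1) < card B" using block_index_less[OF j, of "k - 1"] k by simp
    then have "k * j + k \<le> card B" using k by simp
    then have "h ^ k * card (matching n B (?ok j) A (k * j) 0) \<le> card B ^ k * card (matching n B (?ok j) A (k * j) k)"
      using block_volume_swap by (intro card_matching[OF B(1) _ A h]) auto
    then have "h ^ k * card {\<sigma>\<in>?P. ?ok j \<sigma>} \<le>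
      card B ^ k * card {\<sigma>\<in>?P. ?ok j \<sigma> \<and> (\<forall>i<k. \<sigma> (big_positions n B \<sigma> ! (k * j + i)) \<in> A i)}"
      by (simp add: matching_def)
    then have "real h ^ k * real (card {\<sigma>\<in>?P. ?ok j \<sigma>}) \<le> real (card B) ^ k *
      real (card {\<sigma>\<in>?P. ?ok j \<sigma> \<and> (\<forall>i<k. \<sigma> (big_positions n B \<sigma> ! (k * j + i)) \<in> A i)})"
      by (metis (no_types, lifting) of_nat_le_iff of_nat_mult of_nat_power)
    then show ?thesis using b by (simp add: power_divide field_simps)
  qed
  have "(real h / real (card B)) ^ k * (real ?N - (\<Sum>i\<in>{..<n} - B. s i) / v)
    = (real h / real (card B)) ^ k * perm_avg n (\<lambda>_. real ?N - (\<Sum>i\<in>{..<n} - B. s i) / v)" by simp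
  also have "\<dots> \<le> (real h / real (card B)) ^ k * perm_avg n (\<lambda>\<sigma>. real (card {j. j < ?N \<and> ?ok j \<sigma>}))"
    using card_light_blocks[OF _ B(1) k s v] by (intro mult_left_mono perm_avg_mono) auto
  also have "\<dots> = (\<Sum>j<?N. (real h / real (card B)) ^ k * real (card {\<sigma>\<in>?P. ?ok j \<sigma>})) / fact n"
    unfolding count by (simp add: sum_distrib_left)
  also have "\<dots> \<le> (\<Sum>j<?N. real (card {\<sigma>\<in>?P. ?ok j \<sigma> \<and> (\<forall>i<k. \<sigma> (big_positions n B \<sigma> ! (k * j + i)) \<in> A i)})) / fact n"
    using step by (intro divide_right_mono sum_mono) auto
  also have "\<dots> = perm_avg n (\<lambda>\<sigma>. real (card {j. good_block n B s k v A \<sigma> j}))"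
    unfolding good_block_def by (rule count[symmetric])
  finally show ?thesis .
qed

text \<open>Each such block has its own first big item in the prefix, and a prefix of length p
  contains on average the fraction p / n of all big items.\<close>

lemma perm_avg_early_blocks:
  assumes B: "B \<subseteq> {..<n}" and k: "k > 0" and p: "p \<le> n" and n: "n > 0"
  shows "perm_avg n (\<lambda>\<sigma>. real (card {j. j < card B div k \<and> block_start n B k \<sigma> j < p}))
    \<le> real p / real n * real (card B)"
proof -
  let ?f = "\<lambda>i. if i \<in> B then 1 else 0 :: real"
  have "perm_avg n (\<lambda>\<sigma>. real (card {j. j < card B div k \<and> block_start n B k \<sigma> j < p}))
    \<le> perm_avg n (\<lambda>\<sigma>. \<Sum>i<p. ?f (\<sigma> i))"
  proof (rule perm_avg_mono)
    fix \<sigma> assume \<sigma>: "\<sigma> permutes {..<n}"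
    have len: "length (big_positions n B \<sigma>) = card B" by (rule length_big_positions[OF \<sigma> B])
    have "inj_on (block_start n B k \<sigma>) {j. j < card B div k \<and> block_start n B k \<sigma> j < p}"
    proof (rule inj_onI)
      fix j j' assume "j \<in> {j. j < card B div k \<and> block_start n B k \<sigma> j < p}"
        "j' \<in> {j. j < card B div k \<and> block_start n B k \<sigma> j < p}"
        and eq: "block_start n B k \<sigma> j = block_start n B k \<sigma> j'"
      then have "k * j < card B" "k * j' < card B" using block_index_less[of _ "card B" k 0] k by auto
      then have "k * j = k * j'"
        using eq nth_eq_iff_index_eq[OF distinct_big_positions] len unfolding block_start_def by metis
      then show "j = j'" using k by simp
    qed
    moreover have "block_start n B k \<sigma> ` {j. j < card B div k \<and> block_start n B k \<sigma> j < p} \<subseteq> {i. i < p \<and> \<sigma> i \<in> B}"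
      using big_positions_nth(2)[of _ n B \<sigma>] len block_index_less[of _ "card B" k 0] k
      by (auto simp: block_start_def)
    ultimately have "card {j. j < card B div k \<and> block_start n B k \<sigma> j < p} \<le> card {i. i < p \<and> \<sigma> i \<in> B}"
      by (intro card_inj_on_le) auto
    moreover have "real (card {i. i < p \<and> \<sigma> i \<in> B}) = (\<Sum>i<p. ?f (\<sigma> i))"
      by (simp add: sum.If_cases Int_def)
    ultimately show "real (card {j. j < card B div k \<and> block_start n B k \<sigma> j < p}) \<le> (\<Sum>i<p. ?f (\<sigma> i))"
      by linarith
  qed
  also have "\<dots> = (\<Sum>i<p. (\<Sum>j<n. ?f j) / real n)"
    unfolding perm_avg_sum using p perm_avg_single[of _ n ?f] by (intro sum.cong) auto
  also have "(\<Sum>j<n. ?f j) = real (card B)" using B by (simp add: sum.If_cases Int_absorb1)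
  finally show ?thesis by simp
qed

section \<open>Gains along a random permutation\<close>

definition big_items :: "real list \<Rightarrow> nat set" where
  "big_items I = {i. i < length I \<and> I ! i > 8/25}"

lemma big_items_subset: "big_items I \<subseteq> {..<length I}"
  by (auto simp: big_items_def)

lemma permuted_nth_big:
  assumes "\<sigma> permutes {..<length I}" "p < length I"
  shows "permute_list \<sigma> I ! p > 8/25 \<longleftrightarrow> \<sigma> p \<in> big_items I"
  using assms permutes_in_image[OF assms(1), of p] by (simp add: permute_list_nth big_items_def)

text \<open>After t nothing is wasteful, so a block that cannot be calm contains a gain. A gainful
  item is big and its rank divided by k recovers its block, so different blocks yield different
  gains.\<close>

lemma good_blocks_le_gains:
  fixes I :: "real list"
  defines "n \<equiv> length I" and "B \<equiv> big_items I"
  assumes \<sigma>: "\<sigma> permutes {..<n}" and pos: "\<forall>x\<in>set I. 0 < x" and k: "k > 0"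
    and nw: "\<forall>p\<in>{t..<n}. \<not> wasteful (state_at (permute_list \<sigma> I) p) (permute_list \<sigma> I ! p)"
    and restless: "\<And>bs w y. half_full bs \<Longrightarrow> \<forall>x\<in>set w. 0 < x \<Longrightarrow> \<forall>i<k. y i \<in> A i \<Longrightarrow>
      filter (\<lambda>x. x > 8/25) w = map (\<lambda>i. I ! y i) [0..<k] \<Longrightarrow>
      sum_list (filter (\<lambda>x. x \<le> 8/25) w) \<le> v \<Longrightarrow> \<not> calm bs w"
  shows "card {j. good_block n B ((!) I) k v A \<sigma> j \<and> t \<le> block_start n B k \<sigma> j}
    \<le> card {p\<in>{t..<n}. gainful (state_at (permute_list \<sigma> I) p) (permute_list \<sigma> I ! p)}"
proof -
  define J where "J = permute_list \<sigma> I"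
  define q where "q = big_positions n B \<sigma>"
  define G where "G = {p\<in>{t..<n}. gainful (state_at J p) (J ! p)}"
  have lenJ: "length J = n" by (simp add: J_def n_def)
  have posJ: "\<forall>x\<in>set J. 0 < x" using pos \<sigma> unfolding J_def n_def by (simp add: set_permute_list)
  have J_nth: "J ! p = I ! \<sigma> p" if "p < n" for p using that \<sigma> unfolding J_def n_def by (simp add: permute_list_nth)
  have J_big: "J ! p > 8/25 \<longleftrightarrow> \<sigma> p \<in> B" if "p < n" for p
    using permuted_nth_big[of \<sigma> I p] that \<sigma> unfolding J_def n_def B_def by simp
  have lenq: "length q = card B"
    unfolding q_def using length_big_positions[OF \<sigma>] big_items_subset by (simp add: n_def B_def)
  have block: "\<exists>r<card B. r div k = j \<and> q ! r \<in> G"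
    if good: "good_block n B ((!) I) k v A \<sigma> j" and late: "t \<le> block_start n B k \<sigma> j" for j
  proof -
    have j: "j < card B div k" using good by (simp add: good_block_def)
    define lo where "lo = block_start n B k \<sigma> j"
    define hi where "hi = Suc (block_last n B k \<sigma> j)"
    have lo: "lo = q ! (k * j)" by (simp add: lo_def block_start_def q_def)
    have hi: "hi = Suc (q ! (k * j + (k - 1)))" by (simp add: hi_def block_last_def q_def)
    have r1: "k * j + (k - 1) < length q" using block_index_less[OF j, of "k - 1"] k lenq by simp
    have hin: "hi \<le> n" using big_positions_nth(1)[OF r1[unfolded q_def]] by (simp add: hi q_def)
    have lohi: "lo \<le> hi"
      using big_positions_le_iff[of "k * j" n B \<sigma> "k * j + (k - 1)"] r1 unfolding lo hi q_def by auto
    define w where "w = map ((!) J) [lo..<hi]"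
    have flt: "filter (\<lambda>p. \<sigma> p \<in> B) [lo..<hi] = map ((!) q) [k * j..<Suc (k * j + (k - 1))]"
      unfolding lo hi q_def using r1 by (intro filter_big_positions) (auto simp: q_def)
    have "filter (\<lambda>x. x > 8/25) w = map ((!) J) (filter (\<lambda>p. J ! p > 8/25) [lo..<hi])"
      by (simp add: w_def filter_map comp_def)
    also have "filter (\<lambda>p. J ! p > 8/25) [lo..<hi] = filter (\<lambda>p. \<sigma> p \<in> B) [lo..<hi]"
      using hin J_big by (intro filter_cong) auto
    also note flt
    also have "[k * j..<Suc (k * j + (k - 1))] = map (\<lambda>i. k * j + i) [0..<k]"
      using k by (simp add: map_add_upt add.commute)
    also have "map ((!) J) (map ((!) q) (map (\<lambda>i. k * j + i) [0..<k])) = map (\<lambda>i. I ! \<sigma> (q ! (k * j + i))) [0..<k]"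
    proof -
      have "q ! (k * j + i) < n" if "i < k" for i
        unfolding q_def using big_positions_nth(1) block_index_less[OF j that] lenq by (simp add: q_def)
      then show ?thesis by (auto simp: J_nth)
    qed
    finally have fb: "filter (\<lambda>x. x > 8/25) w = map (\<lambda>i. I ! \<sigma> (q ! (k * j + i))) [0..<k]" .
    have "sum_list (filter (\<lambda>x. x \<le> 8/25) w) = sum_list (map ((!) J) (filter (\<lambda>p. J ! p \<le> 8/25) [lo..<hi]))"
      by (simp add: w_def filter_map comp_def)
    also have "\<dots> = (\<Sum>p\<in>set (filter (\<lambda>p. J ! p \<le> 8/25) [lo..<hi]). J ! p)"
      by (intro sum_list_distinct_conv_sum_set) simp
    also have "\<dots> = block_volume n B ((!) I) k \<sigma> j"
      unfolding block_volume_def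
      using hin J_big J_nth by (intro sum.cong) (auto simp: lo_def hi_def not_less[symmetric])
    also have "\<dots> \<le> v" using good by (simp add: good_block_def)
    finally have vol: "sum_list (filter (\<lambda>x. x \<le> 8/25) w) \<le> v" .
    have posw: "\<forall>x\<in>set w. 0 < x" using posJ hin lenJ by (auto simp: w_def)
    have "\<not> calm (state_at J lo) w"
      using good by (intro restless[OF state_at_half_full[OF posJ] posw _ fb vol]) (simp add: good_block_def q_def)
    then obtain p where p: "p \<in> {lo..<hi}" "wasteful (state_at J p) (J ! p) \<or> gainful (state_at J p) (J ! p)"
      using calm_state_at[OF lohi, of J] hin lenJ unfolding w_def by blast
    have pt: "p \<in> {t..<n}" using p(1) late hin by (simp add: lo_def)
    then have g: "gainful (state_at J p) (J ! p)" using p(2) nw unfolding J_def by blast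
    then have "p \<in> set (filter (\<lambda>p. \<sigma> p \<in> B) [lo..<hi])" using p(1) pt J_big[of p] by (simp add: gainful_def)
    then have "p \<in> (!) q ` {k * j..<Suc (k * j + (k - 1))}"
      unfolding flt by (simp del: upt_Suc)
    then obtain r where r: "p = q ! r" "k * j \<le> r" "r < k * j + k" using k by auto
    have "r div k = j" using r(2,3) by (intro div_nat_eqI) (auto simp: mult.commute)
    moreover have "r < card B" using r(3) r1 lenq k by linarith
    ultimately show ?thesis using r(1) pt g by (auto simp: G_def)
  qed
  have "{j. good_block n B ((!) I) k v A \<sigma> j \<and> t \<le> block_start n B k \<sigma> j}
    \<subseteq> (\<lambda>r. r div k) ` {r. r < card B \<and> q ! r \<in> G}" using block by blast
  then have "card {j. good_block n B ((!) I) k v A \<sigma> j \<and> t \<le> block_start n B k \<sigma> j} \<le> card {r. r < card B \<and> q ! r \<in> G}"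
    by (rule surj_card_le[rotated]) simp
  also have "\<dots> \<le> card G"
  proof (rule card_inj_on_le)
    show "inj_on ((!) q) {r. r < card B \<and> q ! r \<in> G}"
      using distinct_big_positions[of n B \<sigma>] lenq unfolding q_def
      by (auto simp: inj_on_def nth_eq_iff_index_eq)
  qed (auto simp: G_def)
  finally show ?thesis by (simp add: G_def J_def)
qed

text \<open>Needed because t will depend on the permutation. Prefix sums of a nonnegative function
  are monotone, so t is squeezed between points of a grid of K + 1 lengths; the sum over the grid
  replaces the maximum.\<close>

lemma prefix_sum_uniform:
  fixes f :: "nat \<Rightarrow> real"
  assumes \<sigma>: "\<sigma> permutes {..<n}" and t: "t \<le> n" and n: "n > 0" and K: "K > 0" and f: "\<And>i. i < n \<Longrightarrow> f i \<ge> 0"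
  defines "F \<equiv> \<Sum>i<n. f i"
  shows "\<bar>(\<Sum>i<t. f (\<sigma> i)) - real t / real n * F\<bar> \<le> F / real K + F / real n +
    (\<Sum>l\<le>K. \<bar>(\<Sum>i<l * n div K. f (\<sigma> i)) - real (l * n div K) / real n * F\<bar>)"
proof -
  define D where "D l = \<bar>(\<Sum>i<l * n div K. f (\<sigma> i)) - real (l * n div K) / real n * F\<bar>" for l
  have F: "F \<ge> 0" unfolding F_def using f by (intro sum_nonneg) auto
  have D_le: "D l \<le> (\<Sum>l\<le>K. D l)" if "l \<le> K" for l
    using that by (intro member_le_sum) (auto simp: D_def)
  have mono: "(\<Sum>i<a. f (\<sigma> i)) \<le> (\<Sum>i<c. f (\<sigma> i))" if "a \<le> c" "c \<le> n" for a c
    using that f permutes_in_image[OF \<sigma>] by (intro sum_mono2) auto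
  \<comment> \<open>u and l are t K / n rounded up and down. One grid step costs F / K, and rounding
    \<open>l * n div K\<close> down costs F / n.\<close>
  define u where "u = (t * K + (n - 1)) div n"
  define l where "l = t * K div n"
  have "u * n \<le> t * K + (n - 1)" unfolding u_def by simp
  moreover have "t * K \<le> u * n"
  proof -
    have "t * K + (n - 1) < u * n + n" 
      unfolding u_def using dividend_less_div_times[OF n, of "t * K + (n - 1)"] by (simp add: add.commute)
    then show ?thesis using n by simp
  qed
  ultimately have u: "t * K \<le> u * n" "u * n \<le> t * K + n" by simp_all
  have l: "l * n \<le> t * K" "t * K \<le> l * n + n"
    unfolding l_def using dividend_less_div_times[OF n, of "t * K"] by simp_all
  have uK: "u \<le> K"
  proof -
    have "t * K + (n - 1) \<le> n * K + (n - 1)" using t by simp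
    then have "u \<le> (n * K + (n - 1)) div n" unfolding u_def by (rule div_le_mono)
    also have "\<dots> = K" using n by (simp add: div_nat_eqI)
    finally show ?thesis .
  qed
  have lK: "l \<le> K"
    unfolding l_def using div_le_mono[of "t * K" "n * K" n] t n by simp
  have up1: "t \<le> u * n div K" using u(1) K by (simp add: less_eq_div_iff_mult_less_eq)
  have up2: "real (u * n div K) \<le> real t + real n / real K"
  proof -
    have "real (u * n div K) \<le> real (u * n) / real K" by (rule of_nat_div_le_of_nat)
    also have "\<dots> \<le> (real t * real K + real n) / real K"
      using u(2) K by (intro divide_right_mono) (simp_all flip: of_nat_mult of_nat_add)
    finally show ?thesis using K by (simp add: add_divide_distrib)
  qed
  have up3: "u * n div K \<le> n" using div_le_mono[of "u * n" "K * n" K] uK K by simp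
  have lo1: "l * n div K \<le> t" using div_le_mono[OF l(1), of K] K by simp
  have lo2: "real (l * n div K) \<ge> real t - real n / real K - 1"
  proof -
    have "real (l * n) / real K \<ge> (real t * real K - real n) / real K"
      using l(2) K by (intro divide_right_mono) (simp_all flip: of_nat_mult of_nat_add add: le_diff_eq diff_le_eq)
    moreover have "real (l * n) / real K \<le> real (l * n div K) + 1"
    proof -
      have "l * n \<le> (l * n div K + 1) * K" using dividend_less_div_times[OF K, of "l * n"] by simp
      then have "real (l * n) \<le> (real (l * n div K) + 1) * real K"
        by (metis of_nat_1 of_nat_add of_nat_le_iff of_nat_mult)
      then show ?thesis using K by (simp add: divide_le_eq)
    qed
    ultimately show ?thesis using K by (simp add: diff_divide_distrib)
  qed
  have "(\<Sum>i<t. f (\<sigma> i)) \<le> (\<Sum>i<u * n div K. f (\<sigma> i))" by (rule mono[OF up1 up3])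
  also have "\<dots> \<le> real (u * n div K) / real n * F + D u" unfolding D_def by linarith
  also have "real (u * n div K) / real n * F \<le> (real t + real n / real K) / real n * F"
    using up2 F by (intro mult_right_mono divide_right_mono) auto
  also have "\<dots> = real t / real n * F + F / real K" using n K by (simp add: field_simps)
  finally have 1: "(\<Sum>i<t. f (\<sigma> i)) \<le> real t / real n * F + F / real K + (\<Sum>l\<le>K. D l)"
    using D_le[OF uK] by linarith
  have "real t / real n * F - F / real K - F / real n = (real t - real n / real K - 1) / real n * F"
    using n K by (simp add: field_simps)
  also have "\<dots> \<le> real (l * n div K) / real n * F"
    using lo2 F by (intro mult_right_mono divide_right_mono) auto
  also have "\<dots> \<le> (\<Sum>i<l * n div K. f (\<sigma> i)) + D l"
  proof -
    have "x \<le> y + \<bar>y - x\<bar>" for x y :: real by linarith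
    then show ?thesis unfolding D_def .
  qed
  also have "(\<Sum>i<l * n div K. f (\<sigma> i)) \<le> (\<Sum>i<t. f (\<sigma> i))" by (rule mono[OF lo1 t])
  finally have "real t / real n * F - F / real K - F / real n \<le> (\<Sum>i<t. f (\<sigma> i)) + (\<Sum>l\<le>K. D l)"
    using D_le[OF lK] by linarith
  moreover have "F / real n \<ge> 0" using F by simp
  ultimately show ?thesis using 1 unfolding D_def[symmetric] by linarith
qed

section \<open>Structure of optimal packings\<close>

lemma Opt_attained:
  assumes "bin_packing_instance I"
  obtains P where "bin_packing I P" "card P = Opt I"
proof -
  have "partition_on {..<length I} ((\<lambda>i. {i}) ` {..<length I})"
    by (rule partition_onI) (auto simp: disjnt_def)
  then have "bin_packing I ((\<lambda>i. {i}) ` {..<length I})"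
    using assms by (auto simp: bin_packing_def bin_packing_instance_def)
  then have "\<exists>k. \<exists>P. bin_packing I P \<and> card P = k" by blast
  from LeastI_ex[OF this] show ?thesis using that unfolding Opt_def by blast
qed

lemma sum_outside: "finite b \<Longrightarrow> (\<Sum>i\<in>b - B. f i) = (\<Sum>i\<in>b. if i \<notin> B then f i else 0)" for f :: "nat \<Rightarrow> real"
  by (simp add: sum.If_cases set_diff_eq Int_def)

definition large_in :: "real list \<Rightarrow> nat set \<Rightarrow> nat set" where
  "large_in I b = {i\<in>b. I ! i > 1/2}"

definition medium_in :: "real list \<Rightarrow> nat set \<Rightarrow> nat set" where
  "medium_in I b = {i\<in>b. 8/25 < I ! i \<and> I ! i \<le> 1/2}"

text \<open>The packing is arbitrary here; \<open>expectation_bound\<close> takes an optimal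
  one.\<close>

locale packed =
  fixes I :: "real list" and P :: "nat set set"
  assumes inst: "bin_packing_instance I" and pack: "bin_packing I P"
begin

abbreviation "n \<equiv> length I"
abbreviation "m \<equiv> card P"
abbreviation "total_weight \<equiv> \<Sum>i<n. item_weight (I ! i)"

definition pairs :: "nat set set" where
  "pairs = {b\<in>P. card (large_in I b) = 1 \<and> card (medium_in I b) = 1}"

definition triples :: "nat set set" where
  "triples = {b\<in>P. card (large_in I b) = 0 \<and> card (medium_in I b) = 3}"

lemma part: "partition_on {..<n} P"
  using pack by (simp add: bin_packing_def)

lemma finite_P: "finite P"
  by (rule finite_elements[OF _ part]) simp

lemma bin_subset: "b \<in> P \<Longrightarrow> b \<subseteq> {..<n}"
  using partition_onD1[OF part] by blast

lemma finite_bin: "b \<in> P \<Longrightarrow> finite b"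
  using bin_subset finite_subset by blast

lemma bin_disjoint: "b \<in> P \<Longrightarrow> b' \<in> P \<Longrightarrow> i \<in> b \<Longrightarrow> i \<in> b' \<Longrightarrow> b = b'"
  using partition_onD2[OF part] unfolding disjoint_def by blast

lemma size_bounds: "i < n \<Longrightarrow> 0 < I ! i" "i < n \<Longrightarrow> I ! i \<le> 1"
  using inst nth_mem unfolding bin_packing_instance_def by blast+

lemma sum_bins: "(\<Sum>i<n. f i) = (\<Sum>b\<in>P. \<Sum>i\<in>b. f i)" for f :: "nat \<Rightarrow> real"
proof -
  have "(\<Sum>i<n. f i) = (\<Sum>i\<in>\<Union>P. f i)" using partition_onD1[OF part] by simp
  also have "\<dots> = (sum \<circ> sum) f P"
    using finite_bin bin_disjoint by (intro sum.Union_disjoint) auto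
  finally show ?thesis by simp
qed

lemma bin_volume: "b \<in> P \<Longrightarrow> (\<Sum>i\<in>b. I ! i) \<le> 1"
  using pack by (simp add: bin_packing_def)

lemma volume_le: "(\<Sum>i<n. I ! i) \<le> real m"
  unfolding sum_bins using sum_mono[of P "\<lambda>b. \<Sum>i\<in>b. I ! i" "\<lambda>_. 1"] bin_volume by simp

lemma sum_indicator: "finite b \<Longrightarrow> (\<Sum>i\<in>b. if Q i then c else 0) = c * real (card {i\<in>b. Q i})" for c :: real
  by (simp add: sum.If_cases Int_def)

text \<open>One volume count with the lower bounds 1/2 (strict) and 8/25 gives everything: two large
  items, a large and two medium ones, or four medium ones would overfill a bin.\<close>

lemma bin_composition:
  assumes b: "b \<in> P"
  shows "card (large_in I b) \<le> 1" "card (large_in I b) = 1 \<Longrightarrow> card (medium_in I b) \<le> 1"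
    "card (medium_in I b) \<le> 3"
    "(\<Sum>i\<in>b - big_items I. I ! i) \<le> 1 - 8/25 * real (card (medium_in I b))"
proof -
  let ?L = "large_in I b" and ?M = "medium_in I b" and ?S = "b - big_items I"
  have fin: "finite b" using finite_bin[OF b] .
  have n: "i < n" if "i \<in> b" for i using bin_subset[OF b] that by auto
  have "b = ?L \<union> (?M \<union> ?S)" using n by (auto simp: large_in_def medium_in_def big_items_def)
  then have "(\<Sum>i\<in>b. I ! i) = (\<Sum>i\<in>?L \<union> (?M \<union> ?S). I ! i)" by simp
  also have "\<dots> = (\<Sum>i\<in>?L. I ! i) + ((\<Sum>i\<in>?M. I ! i) + (\<Sum>i\<in>?S. I ! i))"
    using fin n by (subst sum.union_disjoint, simp_all add: large_in_def medium_in_def big_items_def,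
      fastforce, subst sum.union_disjoint) (auto simp: big_items_def)
  finally have split: "(\<Sum>i\<in>?L. I ! i) + ((\<Sum>i\<in>?M. I ! i) + (\<Sum>i\<in>?S. I ! i)) \<le> 1"
    using bin_volume[OF b] by simp
  have S: "(\<Sum>i\<in>?S. I ! i) \<ge> 0" using n size_bounds by (intro sum_nonneg) (auto intro: less_imp_le)
  have M: "(\<Sum>i\<in>?M. I ! i) \<ge> real (card ?M) * (8/25)"
    by (intro sum_bounded_below) (auto simp: medium_in_def)
  have L: "(\<Sum>i\<in>?L. I ! i) \<ge> real (card ?L) * (1/2)"
    by (intro sum_bounded_below) (auto simp: large_in_def)
  have L': "(\<Sum>i\<in>?L. I ! i) > real (card ?L) * (1/2)" if "?L \<noteq> {}"
    using sum_strict_mono[of ?L "\<lambda>_. 1/2" "\<lambda>i. I ! i"] that fin by (simp add: large_in_def)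
  show L1: "card ?L \<le> 1"
  proof (rule ccontr)
    assume "\<not> card ?L \<le> 1"
    then have "real (card ?L) \<ge> 2" "?L \<noteq> {}" by auto
    then show False using L' split S M by simp
  qed
  show "card ?L = 1 \<Longrightarrow> card ?M \<le> 1"
  proof (rule ccontr)
    assume 1: "card ?L = 1" "\<not> card ?M \<le> 1"
    then have "real (card ?M) \<ge> 2" by simp
    then show False using L split S M 1(1) by simp
  qed
  show "card ?M \<le> 3"
  proof (rule ccontr)
    assume 1: "\<not> card ?M \<le> 3"
    then have "real (card ?M) \<ge> 4" by simp
    then show False using L split S M by simp
  qed
  show "(\<Sum>i\<in>?S. I ! i) \<le> 1 - 8/25 * real (card ?M)" using split L M by simp
qed

lemma bin_weight:
  assumes b: "b \<in> P"
  shows "(\<Sum>i\<in>b. item_weight (I ! i)) = real (card (large_in I b)) + real (card (medium_in I b)) / 2"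
proof -
  have "(\<Sum>i\<in>b. item_weight (I ! i)) =
    (\<Sum>i\<in>b. (if I ! i > 1/2 then 1 else 0) + (if 8/25 < I ! i \<and> I ! i \<le> 1/2 then 1/2 else 0))"
    by (intro sum.cong) (auto simp: item_weight_def)
  then show ?thesis
    unfolding sum.distrib sum_indicator[OF finite_bin[OF b]] by (simp add: large_in_def medium_in_def)
qed

lemma sum_marked: "Q \<subseteq> P \<Longrightarrow> (\<Sum>b\<in>P. if b \<in> Q then c else 0) = c * real (card Q)" for c :: real
  using finite_P by (simp add: sum.If_cases Int_absorb1)

lemma pairs_subset: "pairs \<subseteq> P" and triples_subset: "triples \<subseteq> P" and pairs_triples: "pairs \<inter> triples = {}"
  by (auto simp: pairs_def triples_def)

text \<open>A large item without a medium one, or at most two medium items, weigh at most 1; the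
  only other compositions are pairs and triples, of weight 3/2.\<close>

lemma weight_le: "total_weight \<le> real m + real (card pairs) / 2 + real (card triples) / 2"
proof -
  have "total_weight \<le> (\<Sum>b\<in>P. 1 + ((if b \<in> pairs then 1/2 else 0) + (if b \<in> triples then 1/2 else 0)))"
    unfolding sum_bins
  proof (rule sum_mono)
    fix b assume b: "b \<in> P"
    have L: "card (large_in I b) = 0 \<or> card (large_in I b) = 1" using bin_composition(1)[OF b] by linarith
    have M: "card (medium_in I b) = 0 \<or> card (medium_in I b) = 1 \<or> card (medium_in I b) = 2 \<or> card (medium_in I b) = 3"
      using bin_composition(3)[OF b] by linarith
    show "(\<Sum>i\<in>b. item_weight (I ! i)) \<le> 1 + ((if b \<in> pairs then 1/2 else 0) + (if b \<in> triples then 1/2 else 0))"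
      using L M bin_composition(2)[OF b] b unfolding bin_weight[OF b] pairs_def triples_def by auto
  qed
  also have "\<dots> = real m + (1/2 * real (card pairs) + 1/2 * real (card triples))"
    unfolding sum.distrib using sum_marked[OF pairs_subset] sum_marked[OF triples_subset] by simp
  finally show ?thesis by simp
qed

lemma weight_le': "total_weight \<le> 3/2 * real m"
proof -
  have "card pairs + card triples = card (pairs \<union> triples)"
    using finite_P pairs_subset triples_subset pairs_triples
    by (intro card_Un_disjoint[symmetric]) (auto intro: finite_subset)
  also have "\<dots> \<le> m" using finite_P pairs_subset triples_subset by (intro card_mono) auto
  finally have "real (card pairs) + real (card triples) \<le> real m" by linarith
  then show ?thesis using weight_le by linarith
qed

lemma card_big_bins:
  "real (card (big_items I)) = (\<Sum>b\<in>P. real (card (large_in I b)) + real (card (medium_in I b)))"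
proof -
  have "real (card (big_items I)) = (\<Sum>i<n. if I ! i > 8/25 then 1 else 0)"
    by (simp add: sum.If_cases Int_def big_items_def)
  also have "\<dots> = (\<Sum>b\<in>P. \<Sum>i\<in>b. (if I ! i > 1/2 then 1 else 0) + (if 8/25 < I ! i \<and> I ! i \<le> 1/2 then 1 else 0))"
    unfolding sum_bins by (intro sum.cong) auto
  finally show ?thesis
    using sum_indicator[OF finite_bin] unfolding sum.distrib by (simp add: large_in_def medium_in_def)
qed

lemma card_big_le: "real (card (big_items I)) \<le> 3 * real m"
proof -
  have "real (card (large_in I b)) + real (card (medium_in I b)) \<le> 3" if "b \<in> P" for b
    using bin_composition(1-3)[OF that] by linarith
  then have "(\<Sum>b\<in>P. real (card (large_in I b)) + real (card (medium_in I b))) \<le> (\<Sum>b\<in>P. 3)"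
    by (rule sum_mono)
  then show ?thesis unfolding card_big_bins by simp
qed

lemma card_big_ge: "2 * real (card pairs) \<le> real (card (big_items I))" "3 * real (card triples) \<le> real (card (big_items I))"
proof -
  show "2 * real (card pairs) \<le> real (card (big_items I))"
    unfolding card_big_bins sum_marked[OF pairs_subset, symmetric] by (intro sum_mono) (auto simp: pairs_def)
  show "3 * real (card triples) \<le> real (card (big_items I))"
    unfolding card_big_bins sum_marked[OF triples_subset, symmetric] by (intro sum_mono) (auto simp: triples_def)
qed

text \<open>Three medium items leave at most 1/25 of a bin.\<close>

lemma small_volume_le: "(\<Sum>i\<in>{..<n} - big_items I. I ! i) \<le> real m - 24/25 * real (card triples)"
proof -
  have "(\<Sum>i\<in>{..<n} - big_items I. I ! i) = (\<Sum>i<n. if i \<notin> big_items I then I ! i else 0)"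
    by (rule sum_outside) simp
  also have "\<dots> = (\<Sum>b\<in>P. \<Sum>i\<in>b - big_items I. I ! i)"
    unfolding sum_bins using finite_bin by (intro sum.cong refl sum_outside[symmetric])
  also have "\<dots> \<le> (\<Sum>b\<in>P. 1 - (if b \<in> triples then 24/25 else 0))"
  proof (intro sum_mono)
    fix b assume "b \<in> P"
    then show "(\<Sum>i\<in>b - big_items I. I ! i) \<le> 1 - (if b \<in> triples then 24/25 else 0)"
      using bin_composition(4)[of b] by (auto simp: triples_def)
  qed
  also have "\<dots> = real m - 24/25 * real (card triples)"
    unfolding sum_subtractf using sum_marked[OF triples_subset] by simp
  finally show ?thesis .
qed

end

section \<open>Expected number of bins\<close>

definition prefix_deviation :: "nat \<Rightarrow> nat \<Rightarrow> (nat \<Rightarrow> real) \<Rightarrow> (nat \<Rightarrow> nat) \<Rightarrow> real" where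
  "prefix_deviation n K f \<sigma> =
     (\<Sum>l\<le>K. \<bar>(\<Sum>i<l * n div K. f (\<sigma> i)) - real (l * n div K) / real n * (\<Sum>i<n. f i)\<bar>)"

text \<open>In the unit interval squares do not exceed the values, so the variance is bounded by the
  total v and not by the number of items, which may be far larger than the number of bins.\<close>

lemma perm_avg_prefix_deviation_le:
  assumes "n > 0" "K > 0" "\<And>i. i < n \<Longrightarrow> 0 \<le> f i \<and> f i \<le> 1" "(\<Sum>i<n. f i) \<le> v" "v > 0"
  shows "perm_avg n (prefix_deviation n K f) \<le> real (K + 1) * sqrt v"
proof -
  have "(f i)\<^sup>2 \<le> f i" if "i < n" for i
    using assms(3)[OF that] by (simp add: power2_eq_square mult_left_le)
  then have "(\<Sum>i<n. (f i)\<^sup>2) \<le> (\<Sum>i<n. f i)" by (intro sum_mono) auto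
  then have sq: "(\<Sum>i<n. (f i)\<^sup>2) \<le> v" using assms(4) by simp
  have le: "l * n div K \<le> n" if "l \<le> K" for l
    using div_le_mono[of "l * n" "K * n" K] that assms(2) by simp
  have "perm_avg n (prefix_deviation n K f) =
    (\<Sum>l\<le>K. perm_avg n (\<lambda>\<sigma>. \<bar>(\<Sum>i<l * n div K. f (\<sigma> i)) - real (l * n div K) / real n * (\<Sum>i<n. f i)\<bar>))"
    unfolding prefix_deviation_def[abs_def] by (rule perm_avg_sum)
  also have "\<dots> \<le> (\<Sum>l\<le>K. sqrt v)"
    using le by (intro sum_mono perm_avg_prefix_deviation[OF _ assms(1) sq assms(5)]) auto
  finally show ?thesis by simp
qed

lemma finite_good_blocks: "finite {j. good_block n B s k v A \<sigma> j \<and> Q j}"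
  by (rule finite_subset[of _ "{..<card B div k}"]) (auto simp: good_block_def)

lemma item_weight_bounds: "0 \<le> item_weight x" "item_weight x \<le> 1"
  by (auto simp: item_weight_def)

context packed
begin

lemma m_pos: "n > 0 \<Longrightarrow> m > 0"
proof -
  assume "n > 0"
  then have "P \<noteq> {}" using partition_onD1[OF part] by auto
  then show "m > 0" using finite_P card_gt_0_iff by blast
qed

definition noise :: "nat \<Rightarrow> (nat \<Rightarrow> nat) \<Rightarrow> real" where
  "noise K \<sigma> = 25/17 * prefix_deviation n K ((!) I) \<sigma> + prefix_deviation n K (\<lambda>i. item_weight (I ! i)) \<sigma>"

lemma perm_avg_noise:
  assumes "n > 0" "K > 0"
  shows "perm_avg n (noise K) \<le> 3 * real (K + 1) * sqrt (real m)"
proof -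
  have m: "real m > 0" using m_pos[OF assms(1)] by simp
  have "perm_avg n (noise K) = 25/17 * perm_avg n (prefix_deviation n K ((!) I))
    + perm_avg n (prefix_deviation n K (\<lambda>i. item_weight (I ! i)))"
    unfolding noise_def[abs_def] by (simp only: perm_avg_add perm_avg_cmult)
  also have "perm_avg n (prefix_deviation n K ((!) I)) \<le> real (K + 1) * sqrt (real m)"
    using perm_avg_prefix_deviation_le[OF assms _ volume_le m] size_bounds by (simp add: less_imp_le)
  also have "perm_avg n (prefix_deviation n K (\<lambda>i. item_weight (I ! i))) \<le> real (K + 1) * sqrt (3/2 * real m)"
    using perm_avg_prefix_deviation_le[OF assms _ weight_le'] m item_weight_bounds by simp
  also have "sqrt (3/2 * real m) \<le> 3/2 * sqrt (real m)"
  proof -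
    have "sqrt (3/2 * real m) = sqrt (3/2) * sqrt (real m)" by (rule real_sqrt_mult)
    moreover have "sqrt (3/2) \<le> (3/2 :: real)" by (rule real_le_lsqrt) (simp_all add: power2_eq_square)
    then have "sqrt (3/2) * sqrt (real m) \<le> 3/2 * sqrt (real m)" by (intro mult_right_mono) auto
    ultimately show ?thesis by simp
  qed
  \<comment> \<open>25/17 + 3/2 = 101/34, rounded up to 3.\<close>
  also have "25/17 * (real (K + 1) * sqrt (real m)) + real (K + 1) * (3/2 * sqrt (real m))
    = 101/34 * (real (K + 1) * sqrt (real m))" by simp
  also have "\<dots> \<le> 3 * (real (K + 1) * sqrt (real m))" by (intro mult_right_mono) auto
  finally have "perm_avg n (noise K) \<le> 3 * (real (K + 1) * sqrt (real m))" by (simp add: mult_left_mono)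
  then show ?thesis by (simp only: mult.assoc)
qed

text \<open>\<open>BF_bound\<close> with prefix volume and remaining weight replaced by their
  expected shares. The rounding terms, total over n, are at most 1 for both functions; they raise
  5/2 by at most 25/17 + 1, hence the 5.\<close>

lemma BF_permuted_bound:
  assumes n: "n > 0" and K: "K > 0" and \<sigma>: "\<sigma> permutes {..<n}"
  obtains t where "t \<le> n"
    "\<forall>p\<in>{t..<n}. \<not> wasteful (state_at (permute_list \<sigma> I) p) (permute_list \<sigma> I ! p)"
    "real (BF (permute_list \<sigma> I)) \<le> 5 + 25/17 * (real t / real n * real m) + (1 - real t / real n) * total_weight
       + 3 * real m / real K + noise K \<sigma>
       - real (card {p\<in>{t..<n}. gainful (state_at (permute_list \<sigma> I) p) (permute_list \<sigma> I ! p)}) / 2"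
proof -
  define J where "J = permute_list \<sigma> I"
  have len: "length J = n" by (simp add: J_def)
  have "set J = set I" using \<sigma> unfolding J_def by (simp add: set_permute_list)
  then have pos: "\<forall>x\<in>set J. 0 < x" using inst by (simp add: bin_packing_instance_def)
  obtain t where t: "t \<le> n" "\<forall>p\<in>{t..<n}. \<not> wasteful (state_at J p) (J ! p)"
    "real (BF J) \<le> 5/2 + 25/17 * (\<Sum>i<t. J ! i) + (\<Sum>p=t..<n. item_weight (J ! p))
       - real (card {p\<in>{t..<n}. gainful (state_at J p) (J ! p)}) / 2"
    using BF_bound[OF pos] unfolding len .
  let ?V = "\<Sum>i<n. I ! i" and ?w = "\<lambda>i. item_weight (I ! i)"
  have J: "J ! p = I ! \<sigma> p" if "p < n" for p using that \<sigma> unfolding J_def by (simp add: permute_list_nth)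
  have s1: "(\<Sum>i<t. J ! i) = (\<Sum>i<t. I ! \<sigma> i)" using t(1) by (intro sum.cong) (auto simp: J)
  have "(\<Sum>p=t..<n. item_weight (J ! p)) = (\<Sum>p=t..<n. ?w (\<sigma> p))" by (intro sum.cong) (auto simp: J)
  also have "\<dots> = (\<Sum>p<n. ?w (\<sigma> p)) - (\<Sum>p<t. ?w (\<sigma> p))"
    using sum.atLeastLessThan_concat[of 0 t n "\<lambda>p. ?w (\<sigma> p)"] t(1) by (simp add: atLeast0LessThan)
  also have "(\<Sum>p<n. ?w (\<sigma> p)) = total_weight" by (rule sum_permuted[OF \<sigma>])
  finally have s2: "(\<Sum>p=t..<n. item_weight (J ! p)) = total_weight - (\<Sum>p<t. ?w (\<sigma> p))" .
  have d1: "(\<Sum>i<t. I ! \<sigma> i) \<le> real t / real n * ?V + ?V / real K + ?V / real n + prefix_deviation n K ((!) I) \<sigma>"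
    using prefix_sum_uniform[OF \<sigma> t(1) n K, of "(!) I"] size_bounds
    unfolding prefix_deviation_def by (simp add: less_imp_le)
  have d2: "real t / real n * total_weight - (total_weight / real K + total_weight / real n + prefix_deviation n K ?w \<sigma>)
     \<le> (\<Sum>i<t. ?w (\<sigma> i))"
    using prefix_sum_uniform[OF \<sigma> t(1) n K, of ?w] item_weight_bounds
    unfolding prefix_deviation_def by (simp add: abs_le_iff algebra_simps)
  have Vn: "?V / real n \<le> 1"
    using sum_mono[of "{..<n}" "(!) I" "\<lambda>_. 1"] size_bounds n by (simp add: divide_le_eq)
  have Wn: "total_weight / real n \<le> 1"
    using sum_mono[of "{..<n}" ?w "\<lambda>_. 1"] item_weight_bounds n by (simp add: divide_le_eq)
  have Vt: "real t / real n * ?V \<le> real t / real n * real m" using volume_le by (intro mult_left_mono) auto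
  have "25/17 * (?V / real K) + total_weight / real K \<le> 25/17 * (real m / real K) + (3/2 * real m) / real K"
    using volume_le weight_le' by (intro add_mono mult_left_mono divide_right_mono) auto
  also have "\<dots> = 101/34 * (real m / real K)" by simp
  also have "\<dots> \<le> 3 * (real m / real K)" by (intro mult_right_mono) auto
  also have "\<dots> = 3 * real m / real K" by simp
  finally have VK: "25/17 * (?V / real K) + total_weight / real K \<le> 3 * real m / real K" .
  have "real (BF J) \<le> 5 + 25/17 * (real t / real n * real m) + (total_weight - real t / real n * total_weight)
       + 3 * real m / real K + noise K \<sigma>
       - real (card {p\<in>{t..<n}. gainful (state_at J p) (J ! p)}) / 2"
  proof -
    have "bf \<le> 5 + 25/17 * b + (w - a') + r + (25/17 * dv + dw) - g / 2"
      if "bf \<le> 5/2 + 25/17 * s + (w - s') - g / 2" "s \<le> a + vk + vn + dv" "a' - (wk + wn + dw) \<le> s'"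
        "vn \<le> 1" "wn \<le> 1" "a \<le> b" "25/17 * vk + wk \<le> r"
      for bf b w a' r dv dw g s s' a vk vn wk wn :: real
      using that by linarith
    from this[OF t(3)[unfolded s1 s2] d1 d2 Vn Wn Vt VK] show ?thesis unfolding noise_def .
  qed
  then have "real (BF J) \<le> 5 + 25/17 * (real t / real n * real m) + (1 - real t / real n) * total_weight
       + 3 * real m / real K + noise K \<sigma>
       - real (card {p\<in>{t..<n}. gainful (state_at J p) (J ! p)}) / 2"
    by (simp add: left_diff_distrib)
  then show ?thesis using that[OF t(1)] t(2) unfolding J_def by blast
qed

text \<open>The volume rate 25/17 before t and the weight rate after t are both at most \<gamma>, so
  the estimate is the same for every t.\<close>

lemma expectation_le_of_weight:
  assumes n: "n > 0" and K: "K > 0" and \<gamma>: "total_weight \<le> \<gamma> * real m" "25/17 \<le> \<gamma>"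
  shows "random_order_expectation BF I \<le> 5 + \<gamma> * real m + 3 * real m / real K + 3 * real (K + 1) * sqrt (real m)"
proof -
  have "random_order_expectation BF I \<le> perm_avg n (\<lambda>\<sigma>. (5 + \<gamma> * real m + 3 * real m / real K) + noise K \<sigma>)"
    unfolding random_order_expectation_eq_perm_avg
  proof (rule perm_avg_mono)
    fix \<sigma> assume \<sigma>: "\<sigma> permutes {..<n}"
    obtain t where t: "t \<le> n"
      and "\<forall>p\<in>{t..<n}. \<not> wasteful (state_at (permute_list \<sigma> I) p) (permute_list \<sigma> I ! p)"
      and bf: "real (BF (permute_list \<sigma> I)) \<le> 5 + 25/17 * (real t / real n * real m) + (1 - real t / real n) * total_weight
       + 3 * real m / real K + noise K \<sigma>
       - real (card {p\<in>{t..<n}. gainful (state_at (permute_list \<sigma> I) p) (permute_list \<sigma> I ! p)}) / 2"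
      by (rule BF_permuted_bound[OF n K \<sigma>])
    have \<tau>: "0 \<le> real t / real n" "real t / real n \<le> 1" using t n by auto
    have 1: "25/17 * (real t / real n * real m) \<le> \<gamma> * (real t / real n * real m)"
      using \<gamma>(2) \<tau> by (intro mult_right_mono) auto
    have 2: "(1 - real t / real n) * total_weight \<le> (1 - real t / real n) * (\<gamma> * real m)"
      using \<gamma>(1) \<tau> by (intro mult_left_mono) auto
    have 3: "\<gamma> * (real t / real n * real m) + (1 - real t / real n) * (\<gamma> * real m) = \<gamma> * real m"
      by (simp add: algebra_simps)
    have "bf \<le> (5 + y + r) + z" if "bf \<le> 5 + u + w + r + z - real g / 2" "u \<le> u'" "w \<le> w'" "u' + w' = y"
      for bf y r z u u' w w' :: real and g :: nat using that by simp
    from this[OF bf 1 2 3]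
    show "real (BF (permute_list \<sigma> I)) \<le> (5 + \<gamma> * real m + 3 * real m / real K) + noise K \<sigma>" .
  qed
  also have "\<dots> = (5 + \<gamma> * real m + 3 * real m / real K) + perm_avg n (noise K)"
    by (simp only: perm_avg_add perm_avg_const)
  finally show ?thesis using perm_avg_noise[OF n K] by linarith
qed

text \<open>The position of t decides where the saving comes from. If t exceeds n div d, charging
  25/17 instead of 3/2 on the prefix saves at least m / (34 d), hence X / (102 d) as X is at most 3
  m. Otherwise every block counted by X starts after t or at t and yields a gain worth 1/2. Either
  way X / (102 d) is saved, and only the expectation of X remains.\<close>

lemma expectation_le_of_blocks:
  assumes n: "n > 0" and K: "K > 0" and d: "d > 0" and k: "k > 0"
    and restless: "\<And>bs w y. half_full bs \<Longrightarrow> \<forall>x\<in>set w. 0 < x \<Longrightarrow> \<forall>i<k. y i \<in> A i \<Longrightarrow>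
      filter (\<lambda>x. x > 8/25) w = map (\<lambda>i. I ! y i) [0..<k] \<Longrightarrow>
      sum_list (filter (\<lambda>x. x \<le> 8/25) w) \<le> v \<Longrightarrow> \<not> calm bs w"
    and many: "c * real m \<le> perm_avg n (\<lambda>\<sigma>. real (card {j. good_block n (big_items I) ((!) I) k v A \<sigma> j}))"
  shows "random_order_expectation BF I \<le> 5 + 3/2 * real m + 3 * real m / real K + 3 * real (K + 1) * sqrt (real m)
    - (c * real m - 3 * real m / real d) / (102 * real d)"
proof -
  define B where "B = big_items I"
  define p where "p = n div d"
  \<comment> \<open>Counting from the fixed p instead of the random t makes the expectation
    accessible.\<close>
  define X where "X \<sigma> = real (card {j. good_block n B ((!) I) k v A \<sigma> j \<and> p \<le> block_start n B k \<sigma> j})" for \<sigma>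
  have B: "B \<subseteq> {..<n}" unfolding B_def by (rule big_items_subset)
  have pos: "\<forall>x\<in>set I. 0 < x" using inst by (simp add: bin_packing_instance_def)
  have b: "real (card B) \<le> 3 * real m" unfolding B_def by (rule card_big_le)
  have "X \<sigma> \<le> real (card {..<card B div k})" for \<sigma>
    unfolding X_def by (intro of_nat_mono card_mono) (auto simp: good_block_def)
  moreover have "real (card {..<card B div k}) \<le> real (card B)" by simp
  ultimately have X_le: "X \<sigma> \<le> 3 * real m" for \<sigma> using b by (meson order_trans)
  have pointwise: "real (BF (permute_list \<sigma> I)) \<le>
    (5 + 3/2 * real m + 3 * real m / real K) + (noise K \<sigma> - 1 / (102 * real d) * X \<sigma>)" if \<sigma>: "\<sigma> permutes {..<n}" for \<sigma>
  proof -
    obtain t where t: "t \<le> n"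
      "\<forall>p\<in>{t..<n}. \<not> wasteful (state_at (permute_list \<sigma> I) p) (permute_list \<sigma> I ! p)"
      "real (BF (permute_list \<sigma> I)) \<le> 5 + 25/17 * (real t / real n * real m) + (1 - real t / real n) * total_weight
       + 3 * real m / real K + noise K \<sigma>
       - real (card {p\<in>{t..<n}. gainful (state_at (permute_list \<sigma> I) p) (permute_list \<sigma> I ! p)}) / 2"
      by (rule BF_permuted_bound[OF n K \<sigma>])
    let ?G = "real (card {p\<in>{t..<n}. gainful (state_at (permute_list \<sigma> I) p) (permute_list \<sigma> I ! p)})"
    have \<tau>: "0 \<le> real t / real n" "real t / real n \<le> 1" using t(1) n by auto
    have "(1 - real t / real n) * total_weight \<le> (1 - real t / real n) * (3/2 * real m)"
      using weight_le' \<tau> by (intro mult_left_mono) auto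
    also have "\<dots> = 3/2 * real m - 3/2 * (real t / real n * real m)"
    proof -
      have "(1 - x) * (3/2 * y) = 3/2 * y - 3/2 * (x * y)" for x y :: real
        by (simp only: left_diff_distrib mult_1_left mult.left_commute)
      then show ?thesis .
    qed
    finally have tail_weight: "(1 - real t / real n) * total_weight \<le> 3/2 * real m - 3/2 * (real t / real n * real m)" .
    \<comment> \<open>3/2 - 25/17 = 1/34.\<close>
    have main: "real (BF (permute_list \<sigma> I)) \<le> 5 + 3/2 * real m - 1/34 * (real t / real n * real m)
       + 3 * real m / real K + noise K \<sigma> - ?G / 2"
    proof -
      have "bf \<le> 5 + 3/2 * x - 1/34 * u + r + z - g" if "w \<le> 3/2 * x - 3/2 * u"
        "bf \<le> 5 + 25/17 * u + w + r + z - g" for bf x u w r z g :: real using that by linarith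
      from this[OF tail_weight t(3)] show ?thesis .
    qed
    have "1 / (102 * real d) * X \<sigma> \<le> 1/34 * (real t / real n * real m) + ?G / 2"
    proof (cases "t \<le> p")
      case True
      have "X \<sigma> \<le> real (card {j. good_block n B ((!) I) k v A \<sigma> j \<and> t \<le> block_start n B k \<sigma> j})"
        unfolding X_def using True by (intro of_nat_mono card_mono finite_good_blocks) auto
      also have "\<dots> \<le> ?G"
        unfolding B_def
      proof (rule of_nat_mono, rule good_blocks_le_gains[OF \<sigma> pos k t(2)])
        fix bs w y
        assume "half_full bs" "\<forall>x\<in>set w. 0 < x" "\<forall>i<k. y i \<in> A i"
          "filter (\<lambda>x. x > 8/25) w = map (\<lambda>i. I ! y i) [0..<k]"
          "sum_list (filter (\<lambda>x. x \<le> 8/25) w) \<le> v"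
        then show "\<not> calm bs w" by (rule restless)
      qed
      finally have XG: "X \<sigma> \<le> ?G" .
      have "1 / (102 * real d) * X \<sigma> \<le> 1/2 * X \<sigma>"
        using d by (intro mult_right_mono) (auto simp: X_def field_simps)
      moreover have "0 \<le> 1/34 * (real t / real n * real m)" by simp
      moreover have "y \<le> u + g / 2" if "y \<le> 1/2 * x" "0 \<le> u" "x \<le> g" for y u g x :: real
        using that by linarith
      ultimately show ?thesis using XG by blast
    next
      case False
      then have "n div d < t" by (simp add: p_def)
      then have "n < t * d" using d by (simp add: div_less_iff_less_mult)
      then have "real n \<le> real t * real d" by (metis less_imp_le of_nat_le_iff of_nat_mult)
      then have "1 / real d \<le> real t / real n" using n d by (simp add: field_simps)
      then have "1 / real d * real m \<le> real t / real n * real m" by (intro mult_right_mono) auto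
      moreover have "1 / (102 * real d) * X \<sigma> \<le> 1 / (102 * real d) * (3 * real m)"
        using X_le d by (intro mult_left_mono) auto
      moreover have "1 / (102 * real d) * (3 * real m) = 1/34 * (1 / real d * real m)" by simp
      moreover have "y \<le> 1/34 * u + real g / 2" if "u' \<le> u" "y \<le> y'" "y' = 1/34 * u'"
        for y y' u u' :: real and g :: nat using that by simp
      ultimately show ?thesis by blast
    qed
    moreover have "bf \<le> (5 + x + r) + (z - y)" if "bf \<le> 5 + x - u + r + z - g" "y \<le> u + g"
      for bf x r z y u g :: real using that by linarith
    ultimately show ?thesis using main by blast
  qed
  \<comment> \<open>Dropping the blocks that start before p loses at most 3 m / d on
    average.\<close>
  have "c * real m \<le> perm_avg n (\<lambda>\<sigma>. X \<sigma> + real (card {j. j < card B div k \<and> block_start n B k \<sigma> j < p}))"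
  proof (rule order_trans[OF many[folded B_def] perm_avg_mono])
    fix \<sigma>
    have "card {j. good_block n B ((!) I) k v A \<sigma> j} \<le>
      card ({j. good_block n B ((!) I) k v A \<sigma> j \<and> p \<le> block_start n B k \<sigma> j} \<union>
        {j. j < card B div k \<and> block_start n B k \<sigma> j < p})"
      using finite_good_blocks by (intro card_mono) (auto simp: good_block_def)
    also have "\<dots> \<le> card {j. good_block n B ((!) I) k v A \<sigma> j \<and> p \<le> block_start n B k \<sigma> j} +
      card {j. j < card B div k \<and> block_start n B k \<sigma> j < p}" by (rule card_Un_le)
    finally show "real (card {j. good_block n B ((!) I) k v A \<sigma> j})
      \<le> X \<sigma> + real (card {j. j < card B div k \<and> block_start n B k \<sigma> j < p})"
      unfolding X_def by linarith
  qed
  also have "\<dots> = perm_avg n X + perm_avg n (\<lambda>\<sigma>. real (card {j. j < card B div k \<and> block_start n B k \<sigma> j < p}))"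
    by (rule perm_avg_add)
  also have "perm_avg n (\<lambda>\<sigma>. real (card {j. j < card B div k \<and> block_start n B k \<sigma> j < p})) \<le> real p / real n * real (card B)"
    unfolding p_def by (rule perm_avg_early_blocks[OF B k _ n]) simp
  also have "\<dots> \<le> 1 / real d * (3 * real m)"
  proof (rule mult_mono)
    have "real p \<le> real n / real d" unfolding p_def by (rule of_nat_div_le_of_nat)
    then show "real p / real n \<le> 1 / real d" using n d by (simp add: field_simps)
  qed (use b in auto)
  finally have "c * real m \<le> perm_avg n X + 1 / real d * (3 * real m)" by simp
  then have avgX: "c * real m - 3 * real m / real d \<le> perm_avg n X" by simp
  have "random_order_expectation BF I \<le>
    perm_avg n (\<lambda>\<sigma>. (5 + 3/2 * real m + 3 * real m / real K) + (noise K \<sigma> - 1 / (102 * real d) * X \<sigma>))"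
    unfolding random_order_expectation_eq_perm_avg by (rule perm_avg_mono) (rule pointwise)
  also have "\<dots> = (5 + 3/2 * real m + 3 * real m / real K) + (perm_avg n (noise K) - 1 / (102 * real d) * perm_avg n X)"
    by (simp only: perm_avg_add perm_avg_diff perm_avg_const perm_avg_cmult)
  finally have E: "random_order_expectation BF I \<le> (5 + 3/2 * real m + 3 * real m / real K) +
    (perm_avg n (noise K) - 1 / (102 * real d) * perm_avg n X)" .
  have "1 / (102 * real d) * (c * real m - 3 * real m / real d) \<le> 1 / (102 * real d) * perm_avg n X"
    using avgX by (intro mult_left_mono) auto
  then have gain: "(c * real m - 3 * real m / real d) / (102 * real d) \<le> 1 / (102 * real d) * perm_avg n X"
    by simp
  have "e \<le> a + z - y" if "e \<le> a + (z' - x)" "z' \<le> z" "y \<le> x" for e a z z' x y :: real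
    using that by linarith
  from this[OF E perm_avg_noise[OF n K] gain] show ?thesis .
qed

end

lemma sorted_enumeration:
  fixes f :: "'a \<Rightarrow> real"
  assumes "finite S"
  obtains ys where "distinct ys" "set ys = S" "\<forall>y<length ys. \<forall>x\<le>y. f (ys ! x) \<le> f (ys ! y)"
proof -
  obtain xs where xs: "set xs = S" "distinct xs" using finite_distinct_list[OF assms] by blast
  have "f (sort_key f xs ! x) \<le> f (sort_key f xs ! y)" if "x \<le> y" "y < length (sort_key f xs)" for x y
    using sorted_nth_mono[OF sorted_sort_key[of f xs], of x y] that by simp
  then show ?thesis using that[of "sort_key f xs"] xs by simp
qed

lemma real_less_div_Suc:
  assumes "k > 0"
  shows "real a < real k * (real (a div k) + 1)"
proof -
  have "a < k * (a div k + 1)" using dividend_less_div_times[OF assms, of a] by (simp add: algebra_simps)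
  then have "real a < real (k * (a div k + 1))" by (simp only: of_nat_less_iff)
  then show ?thesis by (simp add: algebra_simps)
qed

text \<open>On a sorted list the slices serve as size classes of equal cardinality.\<close>

definition slice :: "'a list \<Rightarrow> nat \<Rightarrow> nat \<Rightarrow> 'a set" where
  "slice ys h r = (!) ys ` {r * h..<r * h + h}"

lemma sliceE:
  assumes "y \<in> slice ys h r"
  obtains x where "y = ys ! x" "r * h \<le> x" "x < r * h + h"
  using assms unfolding slice_def by auto

lemma slice_bound: "r < k \<Longrightarrow> k * h \<le> N \<Longrightarrow> r * h + h \<le> N" for r k h N :: nat
  by (metis Suc_leI add.commute le_trans mult_Suc mult_le_mono1)

lemma slice_subset: "r * h + h \<le> length ys \<Longrightarrow> slice ys h r \<subseteq> set ys"
  by (auto simp: slice_def)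

lemma card_slice: "distinct ys \<Longrightarrow> r * h + h \<le> length ys \<Longrightarrow> card (slice ys h r) = h"
  unfolding slice_def by (subst card_image) (auto simp: inj_on_def nth_eq_iff_index_eq)

lemma slice_disjoint:
  assumes "distinct ys" "r < r'" "r' * h + h \<le> length ys"
  shows "slice ys h r \<inter> slice ys h r' = {}"
proof -
  have "r * h + h \<le> r' * h" by (rule slice_bound[OF assms(2)]) simp
  then show ?thesis using assms(1,3) by (auto simp: slice_def nth_eq_iff_index_eq)
qed

section \<open>Linearly many good blocks of either kind\<close>

context packed
begin

text \<open>There are at most 3 m big items and each class has at least m / 1200, hence the ratio
  1/3600; the exponent is that of the longer kind of block, so one constant serves both.\<close>

lemma perm_avg_good_blocks_linear:
  assumes k: "k > 0" "k \<le> 7" and v: "v > 0" and m: "m > 0"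
    and A: "\<And>i. i < k \<Longrightarrow> A i \<subseteq> big_items I" "\<And>i i'. i' < i \<Longrightarrow> i < k \<Longrightarrow> A i' \<inter> A i = {}"
    and h: "\<And>i. i < k \<Longrightarrow> h \<le> card (A i)" "real m / 1200 \<le> real h"
    and light: "real m / 1000 \<le> real (card (big_items I) div k) - (\<Sum>i\<in>{..<n} - big_items I. I ! i) / v"
  shows "(1/3600) ^ 7 / 1000 * real m \<le>
    perm_avg n (\<lambda>\<sigma>. real (card {j. good_block n (big_items I) ((!) I) k v A \<sigma> j}))"
proof -
  have "(\<Sum>i\<in>{..<n} - big_items I. I ! i) \<ge> 0"
    using size_bounds by (intro sum_nonneg) (auto intro: less_imp_le)
  then have "(\<Sum>i\<in>{..<n} - big_items I. I ! i) / v \<ge> 0" using v by simp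
  moreover have "real m / 1000 > 0" using m by simp
  ultimately have "real (card (big_items I) div k) > 0" using light by linarith
  then have ne: "big_items I \<noteq> {}" by auto
  have b: "real (card (big_items I)) > 0"
    using ne finite_subset[OF big_items_subset] card_gt_0_iff by (metis finite_lessThan of_nat_0_less_iff)
  have "real (card (big_items I)) \<le> 3600 * real h" using card_big_le h(2) by linarith
  then have ratio: "1/3600 \<le> real h / real (card (big_items I))" using b by (simp add: field_simps)
  have "(1/3600 :: real) ^ 7 \<le> (1/3600) ^ k" using k(2) by (intro power_decreasing) auto
  also have "\<dots> \<le> (real h / real (card (big_items I))) ^ k" using ratio by (intro power_mono) auto
  finally have "(1/3600) ^ 7 * (real m / 1000) \<le> (real h / real (card (big_items I))) ^ k *
      (real (card (big_items I) div k) - (\<Sum>i\<in>{..<n} - big_items I. I ! i) / v)"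
    using light by (intro mult_mono) auto
  also have "\<dots> \<le> perm_avg n (\<lambda>\<sigma>. real (card {j. good_block n (big_items I) ((!) I) k v A \<sigma> j}))"
    using size_bounds by (intro perm_avg_good_blocks[OF big_items_subset ne k(1) _ v A h(1)]) (auto intro: less_imp_le)
  finally show ?thesis by simp
qed

definition large_item :: "nat set \<Rightarrow> nat" where
  "large_item b = (SOME i. i \<in> large_in I b)"

definition medium_item :: "nat set \<Rightarrow> nat" where
  "medium_item b = (SOME i. i \<in> medium_in I b)"

lemma pair_items:
  assumes "b \<in> pairs"
  shows "large_item b \<in> b" "I ! large_item b > 1/2" "medium_item b \<in> b"
    "I ! medium_item b > 8/25" "I ! medium_item b \<le> 1/2" "I ! medium_item b + I ! large_item b \<le> 1"
proof -
  have b: "b \<in> P" using assms pairs_subset by blast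
  have "large_in I b \<noteq> {}" "medium_in I b \<noteq> {}" using assms by (auto simp: pairs_def)
  then have "large_item b \<in> large_in I b" "medium_item b \<in> medium_in I b"
    unfolding large_item_def medium_item_def by (auto intro: someI_ex)
  then show *: "large_item b \<in> b" "I ! large_item b > 1/2" "medium_item b \<in> b"
    "I ! medium_item b > 8/25" "I ! medium_item b \<le> 1/2"
    by (auto simp: large_in_def medium_in_def)
  have "medium_item b \<noteq> large_item b" using * by auto
  then have "I ! medium_item b + I ! large_item b = (\<Sum>i\<in>{medium_item b, large_item b}. I ! i)" by simp
  also have "\<dots> \<le> (\<Sum>i\<in>b. I ! i)"
    using * finite_bin[OF b] bin_subset[OF b] size_bounds(1) by (intro sum_mono2) (auto intro: less_imp_le)
  also have "\<dots> \<le> 1" by (rule bin_volume[OF b])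
  finally show "I ! medium_item b + I ! large_item b \<le> 1" .
qed

text \<open>Sort the pair bins by their medium item: a medium item from the lower half then fits with
  every large item from the upper half.\<close>

lemma expectation_le_of_pairs:
  assumes n: "n > 0" and K: "K > 0" and d: "d > 0" and m: "m \<ge> 1200"
    and many: "real (card pairs) \<ge> real m / 100"
  shows "random_order_expectation BF I \<le> 5 + 3/2 * real m + 3 * real m / real K + 3 * real (K + 1) * sqrt (real m)
    - ((1/3600) ^ 7 / 1000 * real m - 3 * real m / real d) / (102 * real d)"
proof -
  have fin: "finite pairs" using finite_P pairs_subset finite_subset by blast
  obtain ys where ys: "distinct ys" "set ys = pairs"
    and sorted: "\<forall>y<length ys. \<forall>x\<le>y. I ! medium_item (ys ! x) \<le> I ! medium_item (ys ! y)"
    using sorted_enumeration[OF fin, of "\<lambda>b. I ! medium_item b"] by blast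
  have len: "length ys = card pairs" using distinct_card[OF ys(1)] ys(2) by simp
  define h where "h = card pairs div 6"
  have h6: "6 * h \<le> length ys" by (simp add: h_def len)
  define f where "f i = (if even i then medium_item else large_item)" for i :: nat
  \<comment> \<open>Medium classes come from slices 0 to 2 and large classes from slices 3 to 5 of
    the bins sorted by medium item.\<close>
  define r where "r i = (if even i then i div 2 else 3 + i div 2)" for i :: nat
  define A where "A i = f i ` slice ys h (r i)" for i
  have r6: "r i * h + h \<le> length ys" if "i < 6" for i
    by (rule slice_bound[OF _ h6]) (use that in \<open>auto simp: r_def\<close>)
  have sub: "slice ys h (r i) \<subseteq> pairs" if "i < 6" for i using slice_subset[OF r6[OF that]] ys(2) by simp
  have f_in: "f i b \<in> b" if "b \<in> pairs" for i b using pair_items(1,3)[OF that] by (simp add: f_def)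
  have f_inj: "b = b'" if "b \<in> pairs" "b' \<in> pairs" "f i b = f i b'" for i b b'
    using that bin_disjoint[of b b' "f i b"] f_in[of b i] f_in[of b' i] pairs_subset by auto
  have f_lt: "f i b < n" if "b \<in> pairs" for i b using f_in[OF that] bin_subset[of b] that pairs_subset by auto
  have f_even: "8/25 < I ! f i b \<and> I ! f i b \<le> 1/2" if "b \<in> pairs" "even i" for i b
    using pair_items[OF that(1)] that(2) by (simp add: f_def)
  have f_odd: "1/2 < I ! f i b" if "b \<in> pairs" "odd i" for i b
    using pair_items[OF that(1)] that(2) by (simp add: f_def)
  have A_even: "\<exists>x<3 * h. y = medium_item (ys ! x)" if yi: "y \<in> A i" "i < 6" "even i" for y i
  proof -
    obtain x where x: "y = medium_item (ys ! x)" "x < r i * h + h"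
      using yi(1,3) unfolding A_def f_def by (auto elim: sliceE)
    have "r i * h + h \<le> 3 * h" by (rule slice_bound[of _ 3]) (use that in \<open>auto simp: r_def\<close>)
    then have "x < 3 * h" using x(2) by linarith
    then show ?thesis using x(1) by blast
  qed
  have A_odd: "\<exists>x. 3 * h \<le> x \<and> x < length ys \<and> y = large_item (ys ! x)" if yi: "y \<in> A i" "i < 6" "odd i" for y i
  proof -
    obtain x where x: "y = large_item (ys ! x)" "r i * h \<le> x" "x < r i * h + h"
      using yi(1,3) unfolding A_def f_def by (auto elim: sliceE)
    have "3 * h \<le> r i * h" using that by (intro mult_le_mono1) (auto simp: r_def)
    then have "3 * h \<le> x" using x(2) by linarith
    moreover have "x < length ys" using x(3) r6[OF yi(2)] by linarith
    ultimately show ?thesis using x(1) by blast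
  qed
  have even_size: "8/25 < I ! y \<and> I ! y \<le> 1/2" if "y \<in> A i" "i < 6" "even i" for y i
    using that f_even sub[OF that(2)] unfolding A_def by blast
  have odd_size: "1/2 < I ! y" if "y \<in> A i" "i < 6" "odd i" for y i
    using that f_odd sub[OF that(2)] unfolding A_def by blast
  \<comment> \<open>The medium item y is at most the medium item that shares a bin with z.\<close>
  have fit: "I ! y + I ! z \<le> 1" if y: "y \<in> A i" "i < 6" "even i" and z: "z \<in> A j" "j < 6" "odd j" for y z i j
  proof -
    obtain x x' where x: "x < 3 * h" "y = medium_item (ys ! x)" "3 * h \<le> x'" "x' < length ys" "z = large_item (ys ! x')"
      using A_even[OF y] A_odd[OF z] by blast
    have "I ! y \<le> I ! medium_item (ys ! x')" using sorted x by simp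
    moreover have "ys ! x' \<in> pairs" using x(4) ys(2) nth_mem by blast
    ultimately show ?thesis using pair_items(6)[of "ys ! x'"] x(5) by simp
  qed
  show ?thesis
  \<comment> \<open>An alternating block forces a gain with any small volume inside, so the budget
    1000 is chosen merely to keep the number of heavier blocks at most m / 1000, below the number of
    blocks, about m / 300 or more.\<close>
  proof (rule expectation_le_of_blocks[OF n K d, of 6 A 1000])
    fix bs :: "real list list" and w :: "real list" and y :: "nat \<Rightarrow> nat"
    assume *: "half_full bs" "\<forall>x\<in>set w. 0 < x" "\<forall>i<6. y i \<in> A i"
      "filter (\<lambda>x. x > 8/25) w = map (\<lambda>i. I ! y i) [0..<6]"
    have "[0..<6] = [0, 1, 2, 3, 4, 5::nat]" by (simp add: upt_rec)
    then have w: "filter (\<lambda>x. x > 8/25) w = [I ! y 0, I ! y 1, I ! y 2, I ! y 3, I ! y 4, I ! y 5]"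
      using *(4) by simp
    show "\<not> calm bs w"
      by (rule alternating_block_not_calm[OF *(1,2) w])
        (use *(3) even_size[of "y 0" 0] even_size[of "y 2" 2] even_size[of "y 4" 4]
          odd_size[of "y 1" 1] odd_size[of "y 3" 3] odd_size[of "y 5" 5]
          fit[of "y 0" 0 "y 1" 1] fit[of "y 0" 0 "y 3" 3] fit[of "y 0" 0 "y 5" 5]
          fit[of "y 2" 2 "y 1" 1] fit[of "y 2" 2 "y 3" 3] fit[of "y 2" 2 "y 5" 5]
          fit[of "y 4" 4 "y 1" 1] fit[of "y 4" 4 "y 3" 3] fit[of "y 4" 4 "y 5" 5] in simp_all)
  next
    show "(1/3600) ^ 7 / 1000 * real m \<le>
      perm_avg n (\<lambda>\<sigma>. real (card {j. good_block n (big_items I) ((!) I) 6 1000 A \<sigma> j}))"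
    proof (rule perm_avg_good_blocks_linear[where h = h])
      show "m > 0" using m by simp
      show "A i \<subseteq> big_items I" if "i < 6" for i
      proof
        fix y assume y: "y \<in> A i"
        then have "y < n" using f_lt sub[OF that] unfolding A_def by blast
        moreover have "I ! y > 8/25"
        proof (cases "even i")
          case True then show ?thesis using even_size[OF y that] by simp
        next
          case False then show ?thesis using odd_size[OF y that] by simp
        qed
        ultimately show "y \<in> big_items I" by (simp add: big_items_def)
      qed
      show "A i' \<inter> A i = {}" if i: "i' < i" "i < 6" for i i'
      proof (cases "even i = even i'")
        case True
        then have "f i' = f i" "r i' < r i" using i by (auto simp: f_def r_def elim!: evenE oddE)
        moreover have "slice ys h (r i') \<inter> slice ys h (r i) = {}"
          by (rule slice_disjoint[OF ys(1) \<open>r i' < r i\<close> r6[OF i(2)]])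
        ultimately show ?thesis using sub[of i] sub[of i'] i f_inj[of _ _ i] unfolding A_def by fastforce
      next
        case False
        have i': "i' < 6" using i by simp
        show ?thesis
        proof (rule ccontr)
          assume "A i' \<inter> A i \<noteq> {}"
          then obtain y where y: "y \<in> A i'" "y \<in> A i" by blast
          show False
          proof (cases "even i")
            case True
            then show False using False even_size[OF y(2) i(2)] odd_size[OF y(1) i'] by simp
          next
            case odd: False
            then show False using False even_size[OF y(1) i'] odd_size[OF y(2) i(2)] by simp
          qed
        qed
      qed
      show "h \<le> card (A i)" if "i < 6" for i
      proof -
        have "inj_on (f i) (slice ys h (r i))" using f_inj sub[OF that] by (intro inj_onI) blast
        then show ?thesis unfolding A_def using card_slice[OF ys(1) r6[OF that]] by (simp add: card_image)
      qed
      have "real (card pairs) < 6 * (real h + 1)"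
        unfolding h_def using real_less_div_Suc[of 6 "card pairs"] by simp
      \<comment> \<open>h exceeds m / 600 - 1, which is at least m / 1200 once m is at least
        1200.\<close>
      then show "real m / 1200 \<le> real h" using many m by simp
      have "real (card (big_items I)) < 6 * (real (card (big_items I) div 6) + 1)"
        using real_less_div_Suc[of 6 "card (big_items I)"] by simp
      moreover have "(\<Sum>i\<in>{..<n} - big_items I. I ! i) \<le> real m"
        using small_volume_le by (rule order_trans) simp
      ultimately show "real m / 1000 \<le> real (card (big_items I) div 6) - (\<Sum>i\<in>{..<n} - big_items I. I ! i) / 1000"
        using card_big_ge(1) many m by simp
    qed simp_all
  qed simp
qed

text \<open>Despite the name this is a medium item, one of size at most 1/3.\<close>

definition small_item :: "nat set \<Rightarrow> nat" where
  "small_item b = (SOME i. i \<in> medium_in I b \<and> I ! i \<le> 1/3)"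

text \<open>Three items above 1/3 would overfill the bin.\<close>

lemma triple_item:
  assumes "b \<in> triples"
  shows "small_item b \<in> b" "I ! small_item b > 8/25" "I ! small_item b \<le> 1/3"
proof -
  have b: "b \<in> P" using assms triples_subset by blast
  have "\<exists>i. i \<in> medium_in I b \<and> I ! i \<le> 1/3"
  proof (rule ccontr)
    assume no: "\<nexists>i. i \<in> medium_in I b \<and> I ! i \<le> 1/3"
    have c: "card (medium_in I b) = 3" using assms by (simp add: triples_def)
    then have ne: "medium_in I b \<noteq> {}" by auto
    have fin: "finite (medium_in I b)" using finite_bin[OF b] by (simp add: medium_in_def)
    have "(\<Sum>i\<in>medium_in I b. 1/3) < (\<Sum>i\<in>medium_in I b. I ! i)"
      using no by (intro sum_strict_mono[OF fin ne]) force
    also have "\<dots> \<le> (\<Sum>i\<in>b. I ! i)"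
      using finite_bin[OF b] bin_subset[OF b] size_bounds(1)
      by (intro sum_mono2) (auto simp: medium_in_def intro: less_imp_le)
    also have "\<dots> \<le> 1" by (rule bin_volume[OF b])
    finally show False using c by simp
  qed
  then have "small_item b \<in> medium_in I b \<and> I ! small_item b \<le> 1/3"
    unfolding small_item_def by (rule someI_ex)
  then show "small_item b \<in> b" "I ! small_item b > 8/25" "I ! small_item b \<le> 1/3"
    by (auto simp: medium_in_def)
qed

text \<open>One item of size at most 1/3 per triple, sorted by descending size and cut into seven
  slices, gives the classes of a descending block. The small volume is below 0.06 m, so with budget
  1/3 fewer than 0.18 m blocks are heavy, against at least 0.42 m - 1 blocks in all.\<close>

lemma expectation_le_of_triples:
  assumes n: "n > 0" and K: "K > 0" and d: "d > 0" and m: "m \<ge> 1200"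
    and many: "real (card triples) \<ge> 98/100 * real m"
  shows "random_order_expectation BF I \<le> 5 + 3/2 * real m + 3 * real m / real K + 3 * real (K + 1) * sqrt (real m)
    - ((1/3600) ^ 7 / 1000 * real m - 3 * real m / real d) / (102 * real d)"
proof -
  have fin: "finite triples" using finite_P triples_subset finite_subset by blast
  have inj: "inj_on small_item triples"
  proof (rule inj_onI)
    fix b b' assume "b \<in> triples" "b' \<in> triples" "small_item b = small_item b'"
    then show "b = b'"
      using bin_disjoint[of b b' "small_item b"] triple_item(1)[of b] triple_item(1)[of b'] triples_subset by auto
  qed
  \<comment> \<open>Sorting by the negated size makes the enumeration descending.\<close>
  obtain ys where ys: "distinct ys" "set ys = small_item ` triples"
    and sorted: "\<forall>y<length ys. \<forall>x\<le>y. - (I ! (ys ! x)) \<le> - (I ! (ys ! y))"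
    using sorted_enumeration[of "small_item ` triples" "\<lambda>i. - (I ! i)"] fin by blast
  have len: "length ys = card triples" using distinct_card[OF ys(1)] ys(2) card_image[OF inj] by simp
  have item: "y < n \<and> 8/25 < I ! y \<and> I ! y \<le> 1/3" if y: "y \<in> set ys" for y
  proof -
    obtain b where b: "b \<in> triples" "y = small_item b" using y ys(2) by auto
    then show ?thesis using triple_item[OF b(1)] bin_subset[of b] triples_subset by auto
  qed
  define h where "h = card triples div 7"
  have h7: "7 * h \<le> length ys" by (simp add: h_def len)
  have r7: "i * h + h \<le> length ys" if "i < 7" for i by (rule slice_bound[OF that h7])
  have desc: "I ! z \<le> I ! y" if yz: "y \<in> slice ys h i" "z \<in> slice ys h j" "i < j" "j < 7" for y z i j
  proof -
    obtain x x' where x: "y = ys ! x" "x < i * h + h" "z = ys ! x'" "j * h \<le> x'" "x' < j * h + h"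
      using yz(1,2) by (auto elim!: sliceE)
    have "i * h + h \<le> j * h" by (rule slice_bound[OF yz(3)]) simp
    then have "x \<le> x'" "x' < length ys" using x r7[OF yz(4)] by auto
    then show ?thesis using sorted x by fastforce
  qed
  show ?thesis
  proof (rule expectation_le_of_blocks[OF n K d, of 7 "slice ys h" "1/3"])
    fix bs :: "real list list" and w :: "real list" and y :: "nat \<Rightarrow> nat"
    assume *: "half_full bs" "\<forall>x\<in>set w. 0 < x" "\<forall>i<7. y i \<in> slice ys h i"
      "filter (\<lambda>x. x > 8/25) w = map (\<lambda>i. I ! y i) [0..<7]"
      "sum_list (filter (\<lambda>x. x \<le> 8/25) w) \<le> 1/3"
    have "[0..<7] = [0, 1, 2, 3, 4, 5, 6::nat]" by (simp add: upt_rec)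
    then have w: "filter (\<lambda>x. x > 8/25) w = [I ! y 0, I ! y 1, I ! y 2, I ! y 3, I ! y 4, I ! y 5, I ! y 6]"
      using *(4) by simp
    have step: "I ! y (Suc i) \<le> I ! y i" if "i < 6" for i
      using desc[of "y i" i "y (Suc i)" "Suc i"] *(3) that by simp
    have "I ! y 0 \<le> 1/3" using item[of "y 0"] slice_subset[OF r7[of 0]] *(3) by force
    then show "\<not> calm bs w"
      using descending_block_not_calm[OF *(1,2) w _ _ _ _ _ _ _ *(5)] step[of 0] step[of 1] step[of 2]
        step[of 3] step[of 4] step[of 5] by (simp add: eval_nat_numeral)
  next
    show "(1/3600) ^ 7 / 1000 * real m \<le>
      perm_avg n (\<lambda>\<sigma>. real (card {j. good_block n (big_items I) ((!) I) 7 (1/3) (slice ys h) \<sigma> j}))"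
    proof (rule perm_avg_good_blocks_linear[where h = h])
      show "m > 0" using m by simp
      show "slice ys h i \<subseteq> big_items I" if "i < 7" for i
        using slice_subset[OF r7[OF that]] item by (auto simp: big_items_def)
      show "slice ys h i' \<inter> slice ys h i = {}" if i: "i' < i" "i < 7" for i i'
        by (rule slice_disjoint[OF ys(1) i(1) r7[OF i(2)]])
      show "h \<le> card (slice ys h i)" if "i < 7" for i using card_slice[OF ys(1) r7[OF that]] by simp
      have "real (card triples) < 7 * (real h + 1)"
        unfolding h_def using real_less_div_Suc[of 7 "card triples"] by simp
      then show "real m / 1200 \<le> real h" using many m by simp
      have "real (card (big_items I)) < 7 * (real (card (big_items I) div 7) + 1)"
        using real_less_div_Suc[of 7 "card (big_items I)"] by simp
      then show "real m / 1000 \<le> real (card (big_items I) div 7) - (\<Sum>i\<in>{..<n} - big_items I. I ! i) / (1/3)"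
        using card_big_ge(2) small_volume_le many m by simp
    qed simp_all
  qed simp
qed

end

lemma expectation_bound:
  fixes c :: real and d K :: nat
  defines "c \<equiv> (1/3600) ^ 7 / 1000"
  assumes inst: "bin_packing_instance I" and d: "d > 0" "3 / real d \<le> c / 2"
    and K: "K > 0" "3 / real K \<le> c / (408 * real d)"
  shows "random_order_expectation BF I \<le>
    (3/2 - c / (408 * real d)) * real (Opt I) + (11 + 3 * real (K + 1) * sqrt (real (Opt I)))"
proof (cases "I = []")
  case True
  have "random_order_expectation BF I = 0"
    unfolding random_order_expectation_eq_perm_avg True by (simp add: perm_avg_def BF_def)
  moreover have "Opt I = 0"
  proof -
    have "bin_packing [] {}" by (simp add: bin_packing_def partition_on_def)
    then have "\<exists>P. bin_packing [] P \<and> card P = 0" by (intro exI[of _ "{}"]) simp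
    then show ?thesis unfolding True Opt_def by (rule Least_eq_0)
  qed
  ultimately show ?thesis by simp
next
  case False
  then have n: "length I > 0" by simp
  obtain P where P: "bin_packing I P" "card P = Opt I" using Opt_attained[OF inst] .
  interpret packed I P using inst P(1) by unfold_locales
  let ?m = "real (card P)" and ?noise = "3 * real (K + 1) * sqrt (real (card P))"
  \<comment> \<open>Good blocks save at least (c / 2) m / (102 d), which is 2 \<epsilon> m; the grid
    error 3 m / K uses up one \<epsilon> m.\<close>
  define \<epsilon> where "\<epsilon> = c / (408 * real d)"
  have "(1/3600 :: real) ^ 7 \<le> 1" by (rule power_le_one) auto
  then have c: "0 < c" "c \<le> 1" by (simp_all add: c_def)
  have "c / (408 * real d) \<le> 1 / 408" using c d(1) by (simp add: field_simps)
  then have \<epsilon>: "0 < \<epsilon>" "\<epsilon> \<le> 1/408" using c d(1) by (simp_all add: \<epsilon>_def)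
  have "3 / real K * ?m \<le> \<epsilon> * ?m" using K(2) unfolding \<epsilon>_def by (intro mult_right_mono) auto
  then have Km: "3 * ?m / real K \<le> \<epsilon> * ?m" by simp
  have block_case: "e \<le> (3/2 - \<epsilon>) * ?m + (11 + ?noise)"
    if "e \<le> 5 + 3/2 * ?m + 3 * ?m / real K + ?noise - (c * ?m - 3 * ?m / real d) / (102 * real d)" for e
  proof -
    have "3 / real d * ?m \<le> c / 2 * ?m" using d(2) by (intro mult_right_mono) auto
    then have "c / 2 * ?m \<le> c * ?m - 3 * ?m / real d" by simp
    then have "c / 2 * ?m / (102 * real d) \<le> (c * ?m - 3 * ?m / real d) / (102 * real d)"
      by (intro divide_right_mono) auto
    moreover have "c / 2 * ?m / (102 * real d) = 2 * (\<epsilon> * ?m)" by (simp add: \<epsilon>_def)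
    ultimately show ?thesis using that Km by (simp add: left_diff_distrib)
  qed
  have "random_order_expectation BF I \<le> (3/2 - \<epsilon>) * ?m + (11 + ?noise)"
  proof -
    \<comment> \<open>If pairs and triples exceed 99/100 of the bins and pairs stay below 1/100,
      then triples exceed 98/100.\<close>
    consider (light) "real (card pairs) + real (card triples) \<le> 99/100 * ?m" | (few) "card P < 1200"
      | (pairs) "card P \<ge> 1200" "real (card pairs) \<ge> ?m / 100"
      | (triples) "card P \<ge> 1200" "real (card triples) \<ge> 98/100 * ?m" by linarith
    then show ?thesis
    proof cases
      case light
      have "total_weight \<le> 299/200 * ?m" using weight_le light by linarith
      then have "random_order_expectation BF I \<le> 5 + 299/200 * ?m + 3 * ?m / real K + ?noise"
        by (intro expectation_le_of_weight[OF n K(1)]) auto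
      \<comment> \<open>2/408 is below 1/200, the distance from 299/200 to 3/2.\<close>
      moreover have "\<epsilon> * ?m \<le> 1/408 * ?m" using \<epsilon> by (intro mult_right_mono) auto
      ultimately show ?thesis using Km by (simp add: left_diff_distrib)
    next
      case few
      have "random_order_expectation BF I \<le> 5 + 3/2 * ?m + 3 * ?m / real K + ?noise"
        by (rule expectation_le_of_weight[OF n K(1) weight_le']) simp
      \<comment> \<open>2 * 1200 / 408 is below 6, hence the additive constant 11 = 5 + 6.\<close>
      moreover have "\<epsilon> * ?m \<le> 1/408 * 1200" using \<epsilon> few by (intro mult_mono) auto
      ultimately show ?thesis using Km by (simp add: left_diff_distrib)
    next
      case pairs
      show ?thesis using block_case[OF expectation_le_of_pairs[OF n K(1) d(1) pairs, folded c_def]] .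
    next
      case triples
      show ?thesis using block_case[OF expectation_le_of_triples[OF n K(1) d(1) triples, folded c_def]] .
    qed
  qed
  then show ?thesis unfolding \<epsilon>_def P(2) .
qed

theorem theorem1p1:
  shows "\<exists>\<epsilon>::real. \<epsilon> > 0 \<and>
    (\<exists>g :: nat \<Rightarrow> real. (\<forall>m. 0 \<le> g m) \<and> (\<lambda>m. g m / real m) \<longlonglongrightarrow> 0 \<and>
      (\<forall>I. bin_packing_instance I \<longrightarrow>
        random_order_expectation BF I \<le> (3/2 - \<epsilon>) * real (Opt I) + g (Opt I))) \<and>
    random_order_ratio BF \<le> ereal (3/2 - \<epsilon>)"
proof -
  define c :: real where "c = (1/3600) ^ 7 / 1000"
  \<comment> \<open>d is chosen so that early blocks cost at most half of c, and then K so that the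
    grid error is at most \<epsilon> m, with 1224 = 3 * 408. Both are absolute constants, so g grows
    like sqrt m.\<close>
  define d where "d = nat \<lceil>6 / c\<rceil>"
  define K where "K = nat \<lceil>1224 * real d / c\<rceil>"
  define \<epsilon> where "\<epsilon> = c / (408 * real d)"
  define g where "g m = 11 + 3 * real (K + 1) * sqrt (real m)" for m :: nat
  have c: "c > 0" by (simp add: c_def)
  have d_ge: "6 / c \<le> real d" unfolding d_def by (rule real_nat_ceiling_ge)
  moreover have "6 / c > 0" using c by simp
  ultimately have "real d > 0" by linarith
  then have d: "d > 0" "3 / real d \<le> c / 2" using c d_ge by (simp_all add: field_simps)
  have K_ge: "1224 * real d / c \<le> real K" unfolding K_def by (rule real_nat_ceiling_ge)
  moreover have "1224 * real d / c > 0" using c d(1) by simp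
  ultimately have "real K > 0" by linarith
  then have K: "K > 0" "3 / real K \<le> c / (408 * real d)" using c d(1) K_ge by (simp_all add: field_simps)
  have bound: "random_order_expectation BF I \<le> (3/2 - \<epsilon>) * real (Opt I) + g (Opt I)"
    if "bin_packing_instance I" for I
    unfolding \<epsilon>_def g_def c_def using expectation_bound[OF that d(1) _ K(1)] d(2) K(2) unfolding c_def by blast
  have g0: "0 \<le> g m" for m by (simp add: g_def)
  have lim: "(\<lambda>m. g m / real m) \<longlonglongrightarrow> 0" unfolding g_def by real_asymp
  have "random_order_ratio BF \<le> limsup (\<lambda>m. ereal (3/2 - \<epsilon> + g m / real m))"
    unfolding random_order_ratio_def
  \<comment> \<open>The limsup ignores m = 0, where dividing by m would not give the bound.\<close>
  proof (rule Limsup_mono, rule eventually_mono[OF eventually_gt_at_top[of 0]])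
    fix m :: nat assume m: "0 < m"
    show "(SUP I\<in>{I. bin_packing_instance I \<and> Opt I = m}. ereal (random_order_expectation BF I / real (Opt I)))
      \<le> ereal (3/2 - \<epsilon> + g m / real m)"
    proof (rule SUP_least)
      fix I assume I: "I \<in> {I. bin_packing_instance I \<and> Opt I = m}"
      then have "random_order_expectation BF I / real m \<le> ((3/2 - \<epsilon>) * real m + g m) / real m"
        using bound[of I] by (intro divide_right_mono) auto
      also have "\<dots> = 3/2 - \<epsilon> + g m / real m" using m by (simp add: add_divide_distrib)
      finally show "ereal (random_order_expectation BF I / real (Opt I)) \<le> ereal (3/2 - \<epsilon> + g m / real m)"
        using I by simp
    qed
  qed
  also have "\<dots> = ereal (3/2 - \<epsilon> + 0)"
    by (intro lim_imp_Limsup tendsto_intros lim) simp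
  finally have "random_order_ratio BF \<le> ereal (3/2 - \<epsilon>)" by simp
  moreover have "\<epsilon> > 0" using c d(1) by (simp add: \<epsilon>_def)
  ultimately show ?thesis using bound g0 lim by blast
qed

end
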